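(* Let $T$ be an $n$-dimensional Morse tile of order $\operatorname{ord}(T)$, let $\mu\subset\overline{T}$ be its Morse face (possibly empty) and let $\tau\subset\overline{T}$ be any face of positive dimension of the underlying simplex $\overline{T}$. If $\tau\not\subset\mu$ (resp. $\tau\subset\mu$), then the stellar subdivision $\mathrm{st}_\tau(T)$ carries a Morse shelling using only regular basic tiles (resp. regular Morse tiles) together with a unique tile isomorphic to $T$. If $\emptyset\neq\mu\subsetneq\tau$, then $\mathrm{st}_\tau(T)$ also carries a Morse shelling using two critical tiles of consecutive indices $\dim(\mu)$ and $\dim(\mu)+1$, together with regular basic tiles and exactly $\dim(\mu)-\operatorname{ord}(T)$ regular Morse tiles having $(\dim(\mu)-1)$-dimensional Morse faces and orders ranging from $\operatorname{ord}(T)$ to $\dim(\mu)-1$.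
   Context: A relative simplex $P$ is a simplex $\overline{P}$ (its underlying simplex) deprived of some of its proper faces $\tau_0,\dots,\tau_k$; its geometric realization is $|\overline P|\setminus(|\tau_0|\cup\dots\cup|\tau_k|)$, its faces are the faces of $\overline P$ not contained in $\tau_0\cup\dots\cup\tau_k$, and its dimension is $\dim\overline P$. Two relative simplices are isomorphic if some bijection between the vertex sets of their underlying simplices carries the removed faces of one onto those of the other. A ridge of an $n$-simplex is an $(n-1)$-dimensional face. A basic tile of dimension $n$ and order $k\in\{0,\dots,n+1\}$ is an $n$-simplex deprived of $k$ of its ridges; it has a unique face of least dimension, of dimension $k-1$ (spanned by the vertices opposite to the removed ridges). A critical tile of dimension $n$ and index $k\in\{0,\dots,n\}$ is a basic tile of order $k$ deprived moreover of this $(k-1)$-dimensional face (index $0$: closed simplex; index $n$: open simplex). A Morse tile of dimension $n$ and order $k$ is an $n$-simplex deprived of $k$ ridges together with possibly one further face $\mu$ of codimension at least two not contained in the removed ridges, its Morse face ($\mu=\emptyset$ if there is none). Critical tiles are Morse tiles; a Morse tile (in particular a basic tile) is called regular if it is not a critical tile; the regular basic tiles are the basic tiles of orders $1,\dots,n$. A finite relative simplicial complex $S=K\setminus L$ consists of a finite simplicial complex $K$ and a subcomplex $L$; its elements are the relative simplices $\sigma\setminus(\sigma\cap L)$, $\sigma\in K\setminus L$, and $|S|=|K|\setminus|L|$. A relative simplex $P$ is viewed as the relative complex $\overline P\setminus(\text{removed faces and their faces})$. A tiling of $S$ is a partition of $|S|$ into relative simplices whose underlying simplices belong to $K$, such that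 for every $d\ge0$ the union of the tiles of dimension $>d$ is closed in $|S|$; a shelling of it is an ordering $T_1,\dots,T_N$ of its tiles such that $T_1\cup\dots\cup T_p$ is closed in $|S|$ for all $p$. A Morse shelling is a shelling of a tiling all of whose tiles are Morse tiles. For a simplicial complex $K$ and a nonempty face $\tau$, the stellar subdivision $\mathrm{st}_\tau(K)$ is obtained by removing all simplices containing $\tau$ and adding a new vertex $\hat\tau$ (realized at the barycenter of $|\tau|$) together with all cones $\hat\tau*\rho$, where $\rho$ ranges over faces, not containing $\tau$, of simplices containing $\tau$. For $S=K\setminus L$, $\mathrm{st}_\tau(S)=\mathrm{st}_\tau(K)\setminus\mathrm{st}_\tau(L)$, where $\mathrm{st}_\tau(L)=L$ if $\tau\notin L$; it has the same geometric realization.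
   Formalization: In the last claim ord(T) ≤ dim(μ) is assumed, since otherwise (T critical) dim(μ) − ord(T) = −1 tiles would be asked for; "a unique tile isomorphic to T" is read as one such tile, all others being regular basic (resp. regular Morse). *)

theory Defs
  imports "HOL-Analysis.Analysis"
begin

text \<open>
  Simplices and simplicial complexes are the geometric ones of the library: a simplex is a subset
  of a Euclidean space, its faces are those of \<^const>\<open>face_of\<close> (including the empty face, of
  dimension \<open>-1\<close>), a \<^const>\<open>simplicial_complex\<close> is a finite set of simplices, and its geometric
  realization is its union.
\<close>

abbreviation vertices :: "'a::euclidean_space set \<Rightarrow> 'a set" where
  "vertices P \<equiv> {v. v extreme_point_of P}"

text \<open>
  A relative simplex is encoded as the pair of its underlying simplex and the set of all faces
  contained in the removed ones. Listing all of them, and not just a generating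
  family \<open>\<tau>\<^sub>0, \<dots>, \<tau>\<^sub>k\<close>, makes the encoding unique; the empty face always
  belongs to the list, so that also removing the empty face changes nothing.
\<close>

type_synonym 'a relative_simplex = "'a set \<times> 'a set set"

definition deprive :: "'a::euclidean_space set \<Rightarrow> 'a set set \<Rightarrow> 'a relative_simplex" where
  "deprive P R = (P, {F. F face_of P \<and> F \<subseteq> \<Union>R})"

definition is_relative_simplex :: "'a::euclidean_space relative_simplex \<Rightarrow> bool" where
  "is_relative_simplex T \<longleftrightarrow>
     (\<exists>(n::nat) P R. int n simplex P \<and> (\<forall>F\<in>R. F face_of P \<and> F \<noteq> P) \<and> T = deprive P R)"

abbreviation underlying :: "'a::euclidean_space relative_simplex \<Rightarrow> 'a set" where
  "underlying T \<equiv> fst T"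

abbreviation removed_faces :: "'a::euclidean_space relative_simplex \<Rightarrow> 'a set set" where
  "removed_faces T \<equiv> snd T"

definition isomorphic_relative_simplices ::
    "'a::euclidean_space relative_simplex \<Rightarrow> 'a relative_simplex \<Rightarrow> bool" where
  "isomorphic_relative_simplices T T' \<longleftrightarrow>
     (\<exists>f. bij_betw f (vertices (underlying T)) (vertices (underlying T')) \<and>
          (\<lambda>F. convex hull (f ` vertices F)) ` removed_faces T = removed_faces T')"

text \<open>In dimension \<open>0\<close> the only ridge is the empty face, which \<^const>\<open>facet_of\<close> would exclude.\<close>

definition ridges :: "'a::euclidean_space set \<Rightarrow> 'a set set" where
  "ridges P = {F. F face_of P \<and> aff_dim F = aff_dim P - 1}"

definition basic_tile :: "nat \<Rightarrow> nat \<Rightarrow> 'a::euclidean_space relative_simplex \<Rightarrow> bool" where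
  "basic_tile n k T \<longleftrightarrow>
     (\<exists>P R. int n simplex P \<and> R \<subseteq> ridges P \<and> card R = k \<and> T = deprive P R)"

text \<open>The face spanned by the vertices opposite to the ridges in \<open>R\<close>; empty if \<open>R\<close> is.\<close>

definition opposite_face :: "'a::euclidean_space set \<Rightarrow> 'a set set \<Rightarrow> 'a set" where
  "opposite_face P R = convex hull {v \<in> vertices P. \<exists>F\<in>R. v \<notin> F}"

definition critical_tile :: "nat \<Rightarrow> nat \<Rightarrow> 'a::euclidean_space relative_simplex \<Rightarrow> bool" where
  "critical_tile n k T \<longleftrightarrow>
     k \<le> n \<and>
     (\<exists>P R. int n simplex P \<and> R \<subseteq> ridges P \<and> card R = k \<and>
            T = deprive P (insert (opposite_face P R) R))"

text \<open>Morse tiles of dimension \<open>n\<close>, order \<open>k\<close> and Morse face \<open>\<mu>\<close>, with \<open>\<mu> = {}\<close> if there is none.\<close>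

definition morse_tile ::
    "nat \<Rightarrow> nat \<Rightarrow> 'a::euclidean_space set \<Rightarrow> 'a relative_simplex \<Rightarrow> bool" where
  "morse_tile n k \<mu> T \<longleftrightarrow>
     (\<exists>P R. int n simplex P \<and> R \<subseteq> ridges P \<and> card R = k \<and>
            (\<mu> = {} \<or> \<mu> face_of P \<and> aff_dim \<mu> \<le> int n - 2 \<and> \<not> \<mu> \<subseteq> \<Union>R) \<and>
            T = deprive P (insert \<mu> R))"

definition regular_basic_tile :: "nat \<Rightarrow> 'a::euclidean_space relative_simplex \<Rightarrow> bool" where
  "regular_basic_tile n T \<longleftrightarrow> (\<exists>k. basic_tile n k T) \<and> \<not> (\<exists>k. critical_tile n k T)"

definition regular_morse_tile :: "nat \<Rightarrow> 'a::euclidean_space relative_simplex \<Rightarrow> bool" where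
  "regular_morse_tile n T \<longleftrightarrow> (\<exists>k \<mu>. morse_tile n k \<mu> T) \<and> \<not> (\<exists>k. critical_tile n k T)"

text \<open>The pair \<open>(K, L)\<close> stands for the relative complex \<open>K \<setminus> L\<close>.\<close>

type_synonym 'a relative_complex = "'a set set \<times> 'a set set"

definition is_relative_complex :: "'a::euclidean_space relative_complex \<Rightarrow> bool" where
  "is_relative_complex S \<longleftrightarrow>
     simplicial_complex (fst S) \<and> simplicial_complex (snd S) \<and> snd S \<subseteq> fst S"

definition complex_of :: "'a::euclidean_space relative_simplex \<Rightarrow> 'a relative_complex" where
  "complex_of T = ({F. F face_of underlying T}, removed_faces T)"

definition realization :: "'a::euclidean_space relative_complex \<Rightarrow> 'a set" where
  "realization S = \<Union>(fst S) - \<Union>(snd S)"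

abbreviation simplex_realization :: "'a::euclidean_space relative_simplex \<Rightarrow> 'a set" where
  "simplex_realization T \<equiv> underlying T - \<Union>(removed_faces T)"

definition tiling ::
    "'a::euclidean_space relative_complex \<Rightarrow> 'a relative_simplex set \<Rightarrow> bool" where
  "tiling S \<T> \<longleftrightarrow>
     is_relative_complex S \<and>
     (\<forall>T\<in>\<T>. is_relative_simplex T \<and> underlying T \<in> fst S) \<and>
     disjoint_family_on simplex_realization \<T> \<and>
     (\<Union>T\<in>\<T>. simplex_realization T) = realization S \<and>
     (\<forall>d::nat. closedin (top_of_set (realization S))
        (\<Union>T\<in>{T\<in>\<T>. aff_dim (underlying T) > int d}. simplex_realization T))"

definition shelling ::
    "'a::euclidean_space relative_complex \<Rightarrow> 'a relative_simplex list \<Rightarrow> bool" where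
  "shelling S Ts \<longleftrightarrow>
     distinct Ts \<and> tiling S (set Ts) \<and>
     (\<forall>p\<le>length Ts. closedin (top_of_set (realization S))
        (\<Union>T\<in>set (take p Ts). simplex_realization T))"

definition morse_shelling ::
    "'a::euclidean_space relative_complex \<Rightarrow> 'a relative_simplex list \<Rightarrow> bool" where
  "morse_shelling S Ts \<longleftrightarrow> shelling S Ts \<and> (\<forall>T\<in>set Ts. \<exists>n k \<mu>. morse_tile n k \<mu> T)"

definition barycenter :: "'a::euclidean_space set \<Rightarrow> 'a" where
  "barycenter \<tau> = (\<Sum>v\<in>vertices \<tau>. v) /\<^sub>R real (card (vertices \<tau>))"

text \<open>The case \<open>\<rho> = {}\<close> yields the new vertex itself.\<close>

definition stellar :: "'a::euclidean_space set \<Rightarrow> 'a set set \<Rightarrow> 'a set set" where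
  "stellar \<tau> K =
     {\<sigma> \<in> K. \<not> \<tau> \<subseteq> \<sigma>} \<union>
     {convex hull (insert (barycenter \<tau>) \<rho>) | \<rho>.
        \<not> \<tau> \<subseteq> \<rho> \<and> (\<exists>\<sigma>\<in>K. \<tau> \<subseteq> \<sigma> \<and> \<rho> face_of \<sigma>)}"

definition relative_stellar ::
    "'a::euclidean_space set \<Rightarrow> 'a relative_complex \<Rightarrow> 'a relative_complex" where
  "relative_stellar \<tau> S =
     (stellar \<tau> (fst S), if \<tau> \<in> snd S then stellar \<tau> (snd S) else snd S)"

end

(*
  Let the tile have vertex set V, let A be the set of vertices opposite to its removed ridges, M the
  vertex set of its Morse face, B that of the subdivided face and b the new vertex. The maximal simplices
  of the subdivision are spanned by the sets obtained from V by replacing some v in B with b; a point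
  lies in such a simplex iff v minimizes its barycentric coordinates over B. Enumerating
  B as v_1, ..., v_r and attributing every point to the first vertex that minimizes cuts the tile into r
  pieces whose initial unions are closed. If A \<inter> B comes first, then the i-th piece is a Morse tile: the
  vertices opposite to its removed ridges are v_1, ..., v_(i-1), the elements of A - B, and also b if
  v_i is in A, while its Morse face is spanned by M without v_i, together with b if B is contained in M,
  and is absent if one of the removed ridges already contains it. In the three cases it remains to
  choose how to order the rest of B: B - M first, arbitrarily, or M first.
*)
theory Submission
  imports Defs
begin

section \<open>Faces of a simplex as sets of vertices\<close>

text \<open>Coordinates enter only through one finite set per point, \<open>ssupp x\<close>, the
  vertices of the smallest subdivided simplex containing \<open>x\<close>; after
  \<open>mem_replace_iff\<close> everything is about inclusions of vertex sets. In the piece of v_i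
  a face \<open>G\<close> misses v_i and contains the earlier vertices; it is kept iff the smallest
  original face around it contains \<open>A\<close> and is not inside \<open>M\<close>. The vertex
  \<open>b\<close> in \<open>G\<close> supplies all of \<open>B\<close> at once. If v_i were outside
  \<open>A\<close> with vertices of \<open>A \<inter> B\<close> still to come, the condition would
  be an alternative, \<open>b\<close> or the rest of \<open>A \<inter> B\<close>, removing a
  separate face of codimension two for each of the latter. This is why \<open>A \<inter> B\<close>
  comes first. The order of the rest decides when the Morse face dies, namely as soon as the
  opposite vertices leave it. If \<open>B\<close> is not inside \<open>M\<close>, then
  \<open>b\<close> achieves this while v_i is in \<open>A\<close>, and a vertex outside
  \<open>M\<close> placed right after \<open>A \<inter> B\<close> does so in all later pieces. With
  \<open>M\<close> first, the opposite vertices instead fill the Morse face step by step, and a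
  piece where both coincide is critical.\<close>

lemma vertices_convex_hull:
  "\<not> affine_dependent V \<Longrightarrow> vertices (convex hull V) = (V :: 'a::euclidean_space set)"
  by (simp add: extreme_point_of_convex_hull_affine_independent)

text \<open>Affine independence makes hulls of subsets of \<open>V\<close> intersect like the
  subsets, and extreme points recover a subset from its hull.\<close>

lemma convex_hull_subset_iff:
  fixes V :: "'a::euclidean_space set"
  assumes V: "\<not> affine_dependent V" and "F \<subseteq> V" "G \<subseteq> V"
  shows "convex hull F \<subseteq> convex hull G \<longleftrightarrow> F \<subseteq> G"
proof
  assume *: "convex hull F \<subseteq> convex hull G"
  have "convex hull (F \<inter> G) = convex hull F \<inter> convex hull G"
    by (rule convex_hull_Int) (metis affine_independent_subset V Un_least assms(2,3))
  also have "\<dots> = convex hull F"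
    using * by blast
  finally have "vertices (convex hull (F \<inter> G)) = vertices (convex hull F)"
    by simp
  moreover have "\<not> affine_dependent F" "\<not> affine_dependent (F \<inter> G)"
    using assms affine_independent_subset by (metis, metis inf.coboundedI1)
  ultimately have "F \<inter> G = F"
    by (metis vertices_convex_hull)
  then show "F \<subseteq> G" by blast
qed (rule hull_mono)

lemma convex_hull_inj_on:
  fixes V :: "'a::euclidean_space set"
  assumes "\<not> affine_dependent V"
  shows "inj_on ((hull) convex) (Pow V)"
  by (rule inj_onI) (metis Pow_iff antisym assms convex_hull_subset_iff order_refl)

lemma faces_convex_hull:
  fixes V :: "'a::euclidean_space set"
  assumes "\<not> affine_dependent V"
  shows "{F. F face_of convex hull V} = (hull) convex ` Pow V"
  using assms by (auto simp: face_of_convex_hull_affine_independent)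

lemma aff_dim_convex_hull_independent:
  fixes V :: "'a::euclidean_space set"
  assumes "\<not> affine_dependent V" "F \<subseteq> V"
  shows "aff_dim (convex hull F) = int (card F) - 1"
  using aff_dim_affine_independent[of F] affine_independent_subset[OF assms]
  by (simp add: aff_dim_convex_hull)

lemma ridges_convex_hull:
  fixes V :: "'a::euclidean_space set"
  assumes V: "\<not> affine_dependent V"
  shows "ridges (convex hull V) = (\<lambda>a. convex hull (V - {a})) ` V"
proof -
  have fin: "finite V" using V by (rule aff_independent_finite)
  have card: "card F + 1 = card V \<longleftrightarrow> (\<exists>a\<in>V. F = V - {a})" if "F \<subseteq> V" for F
  proof
    assume "card F + 1 = card V"
    then have "card (V - F) = 1"
      using that fin by (simp add: card_Diff_subset finite_subset)
    then obtain a where "V - F = {a}" by (rule card_1_singletonE)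
    with that show "\<exists>a\<in>V. F = V - {a}" by blast
  next
    assume "\<exists>a\<in>V. F = V - {a}"
    then show "card F + 1 = card V"
      using card_Suc_Diff1[OF fin] by auto
  qed
  have *: "F \<in> ridges (convex hull V) \<longleftrightarrow> (\<exists>c. c \<subseteq> V \<and> F = convex hull c \<and> card c + 1 = card V)" for F
    using V by (auto simp: ridges_def face_of_convex_hull_affine_independent
        aff_dim_convex_hull_independent[OF V] aff_dim_convex_hull_independent[OF V order_refl])
  show ?thesis
  proof (rule set_eqI)
    fix F
    show "F \<in> ridges (convex hull V) \<longleftrightarrow> F \<in> (\<lambda>a. convex hull (V - {a})) ` V"
      unfolding * image_iff using card Diff_subset[of V] by metis
  qed
qed

text \<open>\<open>deprive\<close> compares a face with a whole union; this reduces the comparison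
  to single faces. For \<open>F = {}\<close> the left side would hold even for empty
  \<open>\<G>\<close>.\<close>

lemma convex_hull_subset_Union_iff:
  fixes V :: "'a::euclidean_space set"
  assumes V: "\<not> affine_dependent V" and F: "F \<subseteq> V" "F \<noteq> {}" and \<G>: "\<G> \<subseteq> Pow V"
  shows "convex hull F \<subseteq> \<Union> ((hull) convex ` \<G>) \<longleftrightarrow> (\<exists>G\<in>\<G>. F \<subseteq> G)"
proof
  \<comment> \<open>test the inclusion at a point of the relative interior\<close>
  assume *: "convex hull F \<subseteq> \<Union> ((hull) convex ` \<G>)"
  have Fi: "\<not> affine_dependent F" using V F affine_independent_subset by blast
  obtain x where x: "x \<in> rel_interior (convex hull F)"
    using F rel_interior_eq_empty[of "convex hull F"] by auto
  with * obtain G where G: "G \<in> \<G>" "x \<in> convex hull G"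
    using rel_interior_subset by blast
  have "convex hull (F \<inter> G) = convex hull F \<inter> convex hull G"
    by (rule convex_hull_Int) (metis affine_independent_subset V Un_least F(1) G(1) \<G> PowD subsetD)
  then have xi: "x \<in> convex hull (F \<inter> G)"
    using x G rel_interior_subset by blast
  have "convex hull (F \<inter> G) face_of convex hull F"
    using Fi face_of_convex_hull_affine_independent by (metis inf_le1)
  then have "convex hull F \<subseteq> convex hull (F \<inter> G)"
    by (metis IntI convex_convex_hull disjoint_iff face_of_disjoint_rel_interior order_refl x xi)
  then have "F \<subseteq> F \<inter> G"
    using convex_hull_subset_iff[OF V] F(1) by (metis inf.coboundedI1)
  with G show "\<exists>G\<in>\<G>. F \<subseteq> G" by blast
qed (meson UN_upper hull_mono order_trans)

section \<open>Combinatorial tiles\<close>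

text \<open>
  A subset of \<open>V\<close> spans a face that is kept iff it contains \<open>A\<close>, the vertices opposite to the removed
  ridges, and is not contained in \<open>M\<close>, the vertices of the Morse face.
\<close>

definition tile :: "'a::euclidean_space set \<Rightarrow> 'a set \<Rightarrow> 'a set \<Rightarrow> 'a relative_simplex" where
  "tile V A M = (convex hull V, (hull) convex ` {F. F \<subseteq> V \<and> (\<not> A \<subseteq> F \<or> F \<subseteq> M)})"

lemma underlying_tile [simp]: "underlying (tile V A M) = convex hull V"
  by (simp add: tile_def)

lemma removed_faces_tile:
  "removed_faces (tile V A M) = (hull) convex ` {F. F \<subseteq> V \<and> (\<not> A \<subseteq> F \<or> F \<subseteq> M)}"
  by (simp add: tile_def)

text \<open>A face lies in the ridge opposite to \<open>a\<close> iff it misses \<open>a\<close>, so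
  it escapes all these ridges iff it contains \<open>A\<close>. With \<open>M = {}\<close> only the
  empty face is added, which is on the list anyway.\<close>

lemma deprive_eq_tile:
  fixes V :: "'a::euclidean_space set"
  assumes V: "\<not> affine_dependent V" and "A \<subseteq> V" "M \<subseteq> V"
  shows "deprive (convex hull V) (insert (convex hull M) ((\<lambda>a. convex hull (V - {a})) ` A)) = tile V A M"
proof -
  let ?\<G> = "insert M ((\<lambda>a. V - {a}) ` A)"
  have "convex hull F \<subseteq> \<Union> ((hull) convex ` ?\<G>) \<longleftrightarrow> \<not> A \<subseteq> F \<or> F \<subseteq> M" if "F \<subseteq> V" for F
  proof (cases "F = {}")
    case False
    have "?\<G> \<subseteq> Pow V" using assms by blast
    note convex_hull_subset_Union_iff[OF V that False this]
    also have "(\<exists>G\<in>?\<G>. F \<subseteq> G) \<longleftrightarrow> \<not> A \<subseteq> F \<or> F \<subseteq> M"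
      using that assms(2) by blast
    finally show ?thesis .
  qed simp
  then have "{F. F face_of convex hull V \<and> F \<subseteq> \<Union> ((hull) convex ` ?\<G>)}
      = (hull) convex ` {F. F \<subseteq> V \<and> (\<not> A \<subseteq> F \<or> F \<subseteq> M)}"
    using V by (auto simp: face_of_convex_hull_affine_independent)
  then show ?thesis
    by (simp add: deprive_def tile_def image_image)
qed

lemma deprive_eq_tile_basic:
  fixes V :: "'a::euclidean_space set"
  assumes "\<not> affine_dependent V" and "A \<subseteq> V"
  shows "deprive (convex hull V) ((\<lambda>a. convex hull (V - {a})) ` A) = tile V A {}"
  using deprive_eq_tile[OF assms, of "{}"] by (simp add: deprive_def)

lemma inj_on_opposite_ridge:
  fixes V :: "'a::euclidean_space set"
  assumes V: "\<not> affine_dependent V"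
  shows "inj_on (\<lambda>a. convex hull (V - {a})) V"
proof (rule inj_onI)
  fix a b assume "a \<in> V" "b \<in> V" "convex hull (V - {a}) = convex hull (V - {b})"
  then show "a = b"
    using convex_hull_subset_iff[OF V, of "V - {a}" "V - {b}"] by auto
qed

lemma ridge_set_cases:
  fixes V :: "'a::euclidean_space set"
  assumes V: "\<not> affine_dependent V" and R: "R \<subseteq> ridges (convex hull V)"
  obtains A where "A \<subseteq> V" "R = (\<lambda>a. convex hull (V - {a})) ` A" "card A = card R"
proof -
  obtain A where A: "A \<subseteq> V" "R = (\<lambda>a. convex hull (V - {a})) ` A"
    using R unfolding ridges_convex_hull[OF V] subset_image_iff by blast
  show ?thesis
    by (rule that[OF A]) (simp add: A card_image[OF inj_on_subset[OF inj_on_opposite_ridge[OF V] A(1)]])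
qed

lemma opposite_face_ridges:
  fixes V :: "'a::euclidean_space set"
  assumes V: "\<not> affine_dependent V" and A: "A \<subseteq> V"
  shows "opposite_face (convex hull V) ((\<lambda>a. convex hull (V - {a})) ` A) = convex hull A"
proof -
  have "v \<in> convex hull (V - {a}) \<longleftrightarrow> v \<noteq> a" if "v \<in> V" "a \<in> A" for v a
    using convex_hull_subset_iff[OF V, of "{v}" "V - {a}"] that by simp
  then have "{v \<in> V. \<exists>F\<in>(\<lambda>a. convex hull (V - {a})) ` A. v \<notin> F} = {v \<in> V. \<exists>a\<in>A. v = a}"
    by (simp cong: conj_cong)
  also have "\<dots> = A"
    using A by blast
  finally show ?thesis
    using V by (simp add: opposite_face_def extreme_point_of_convex_hull_affine_independent)
qed

section \<open>Morse, critical and regular tiles in terms of vertex sets\<close>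

lemma simplex_cases:
  fixes P :: "'a::euclidean_space set"
  assumes "int n simplex P"
  obtains V where "\<not> affine_dependent V" "card V = n + 1" "P = convex hull V"
proof -
  obtain C where "\<not> affine_dependent C" "int (card C) = int n + 1" "P = convex hull C"
    using assms by (auto simp: simplex_def)
  then show ?thesis by (intro that[of C]) auto
qed

text \<open>With \<open>card V = n + 1\<close>, codimension at least two reads
  \<open>card M + 1 \<le> n\<close>, and a nonempty Morse face escapes the removed ridges iff
  \<open>A \<subseteq> M\<close>.\<close>

lemma morse_tile_cases:
  fixes T :: "'a::euclidean_space relative_simplex"
  assumes "morse_tile n k \<mu> T"
  obtains V A M where "\<not> affine_dependent V" "card V = n + 1" "A \<subseteq> V" "card A = k" "M \<subseteq> V"
    "\<mu> = convex hull M" "M = {} \<or> A \<subseteq> M \<and> card M + 1 \<le> n" "T = tile V A M"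
proof -
  obtain P R where P: "int n simplex P" and R: "R \<subseteq> ridges P" "card R = k"
    and \<mu>: "\<mu> = {} \<or> \<mu> face_of P \<and> aff_dim \<mu> \<le> int n - 2 \<and> \<not> \<mu> \<subseteq> \<Union>R"
    and T: "T = deprive P (insert \<mu> R)"
    using assms by (auto simp: morse_tile_def)
  obtain V where V: "\<not> affine_dependent V" "card V = n + 1" "P = convex hull V"
    using P by (rule simplex_cases)
  obtain A where A: "A \<subseteq> V" "R = (\<lambda>a. convex hull (V - {a})) ` A" "card A = card R"
    using ridge_set_cases[OF V(1) R(1)[unfolded V(3)]] .
  obtain M where M: "M \<subseteq> V" "\<mu> = convex hull M"
  proof (cases "\<mu> = {}")
    case True
    then show ?thesis by (intro that[of "{}"]) auto
  next
    case False
    then have "\<mu> face_of convex hull V" using \<mu> V by blast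
    then show ?thesis using that unfolding face_of_convex_hull_affine_independent[OF V(1)] by blast
  qed
  have AM: "M = {} \<or> A \<subseteq> M \<and> card M + 1 \<le> n"
  proof (cases "M = {}")
    case False
    then have *: "aff_dim \<mu> \<le> int n - 2" "\<not> \<mu> \<subseteq> \<Union>R" using \<mu> M by auto
    have "a \<in> M" if "a \<in> A" for a
    proof (rule ccontr)
      assume "a \<notin> M"
      then have "convex hull M \<subseteq> convex hull (V - {a})" using M by (intro hull_mono) auto
      then show False using * that M A by auto
    qed
    then show ?thesis
      using * aff_dim_convex_hull_independent[OF V(1) M(1)] M by auto
  qed auto
  have T': "T = tile V A M"
    using T deprive_eq_tile[OF V(1) A(1) M(1)] A(2) M(2) V(3) by simp
  show ?thesis
    by (rule that[OF V(1,2) A(1) _ M AM T']) (simp only: A(3) R(2))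
qed

lemma morse_tileI:
  fixes V :: "'a::euclidean_space set"
  assumes V: "\<not> affine_dependent V" "card V = n + 1" and A: "A \<subseteq> V" and M: "M \<subseteq> V"
    and AM: "M = {} \<or> A \<subseteq> M \<and> card M + 1 \<le> n"
  shows "morse_tile n (card A) (convex hull M) (tile V A M)"
proof -
  let ?R = "(\<lambda>a. convex hull (V - {a})) ` A"
  have "int n simplex (convex hull V)" using V by (auto simp: simplex_def)
  moreover have "?R \<subseteq> ridges (convex hull V)" using A by (auto simp: ridges_convex_hull[OF V(1)])
  moreover have "card ?R = card A"
    by (rule card_image[OF inj_on_subset[OF inj_on_opposite_ridge[OF V(1)] A]])
  moreover have "convex hull M = {} \<or> convex hull M face_of convex hull V \<and>
      aff_dim (convex hull M) \<le> int n - 2 \<and> \<not> convex hull M \<subseteq> \<Union>?R"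
  proof (cases "M = {}")
    case False
    have "\<not> convex hull M \<subseteq> \<Union> ((hull) convex ` (\<lambda>a. V - {a}) ` A)"
      by (subst convex_hull_subset_Union_iff[OF V(1) M False]) (use AM False in auto)
    moreover have "convex hull M face_of convex hull V"
      using M face_of_convex_hull_affine_independent[OF V(1)] by blast
    ultimately show ?thesis
      using AM False aff_dim_convex_hull_independent[OF V(1) M] by (simp add: image_image)
  qed simp
  moreover note deprive_eq_tile[OF V(1) A M, symmetric]
  ultimately show ?thesis
    unfolding morse_tile_def by blast
qed

lemma is_relative_simplex_tile:
  fixes V :: "'a::euclidean_space set"
  assumes V: "\<not> affine_dependent V" "card V = n + 1" and "A \<subseteq> V" "M \<subset> V"
  shows "is_relative_simplex (tile V A M)"
proof -
  have *: "convex hull F face_of convex hull V \<and> convex hull F \<noteq> convex hull V" if "F \<subset> V" for F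
    using that convex_hull_subset_iff[OF V(1), of V F] face_of_convex_hull_affine_independent[OF V(1)]
    by blast
  have "\<forall>F\<in>insert (convex hull M) ((\<lambda>a. convex hull (V - {a})) ` A).
      F face_of convex hull V \<and> F \<noteq> convex hull V"
    using *[of M] *[of "V - {a}" for a] assms(3,4) by blast
  moreover have "int n simplex (convex hull V)" using V by (auto simp: simplex_def)
  ultimately show ?thesis
    unfolding is_relative_simplex_def
    using deprive_eq_tile[OF V(1) assms(3) psubset_imp_subset[OF assms(4)], symmetric] by blast
qed

lemma critical_tileI:
  fixes V :: "'a::euclidean_space set"
  assumes V: "\<not> affine_dependent V" "card V = n + 1" and A: "A \<subseteq> V" "card A \<le> n"
  shows "critical_tile n (card A) (tile V A A)"
proof -
  let ?R = "(\<lambda>a. convex hull (V - {a})) ` A"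
  have "int n simplex (convex hull V)" using V by (auto simp: simplex_def)
  moreover have "?R \<subseteq> ridges (convex hull V)" using A by (auto simp: ridges_convex_hull[OF V(1)])
  moreover have "card ?R = card A"
    by (rule card_image[OF inj_on_subset[OF inj_on_opposite_ridge[OF V(1)] A(1)]])
  ultimately show ?thesis
    unfolding critical_tile_def
    using deprive_eq_tile[OF V(1) A(1) A(1), folded opposite_face_ridges[OF V(1) A(1)], symmetric]
      A(2) by blast
qed

text \<open>Different pairs \<open>(A, M)\<close> can encode the same tile, so criticality has to be
  refuted on the kept faces: in a critical tile they are the proper supersets of one set
  \<open>A'\<close>.\<close>

lemma critical_tile_cases:
  fixes V :: "'a::euclidean_space set"
  assumes V: "\<not> affine_dependent V" and "critical_tile n k (tile V A M)"
  obtains A' where "A' \<subseteq> V" "card A' \<le> n" "\<And>F. F \<subseteq> V \<Longrightarrow> A \<subseteq> F \<and> \<not> F \<subseteq> M \<longleftrightarrow> A' \<subset> F"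
proof -
  obtain P R where P: "int n simplex P" and R: "R \<subseteq> ridges P" "card R \<le> n"
    and T: "tile V A M = deprive P (insert (opposite_face P R) R)"
    using assms(2) by (auto simp: critical_tile_def)
  have P: "P = convex hull V" using T by (metis underlying_tile deprive_def fst_conv)
  obtain A' where A': "A' \<subseteq> V" "R = (\<lambda>a. convex hull (V - {a})) ` A'" "card A' = card R"
    using ridge_set_cases[OF V R(1)[unfolded P]] .
  have "tile V A M = tile V A' A'"
    using T A' by (simp add: P opposite_face_ridges[OF V A'(1)] deprive_eq_tile[OF V A'(1) A'(1)])
  then have "(hull) convex ` {F. F \<subseteq> V \<and> (\<not> A \<subseteq> F \<or> F \<subseteq> M)}
      = (hull) convex ` {F. F \<subseteq> V \<and> (\<not> A' \<subseteq> F \<or> F \<subseteq> A')}"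
    by (simp add: tile_def)
  then have "{F. F \<subseteq> V \<and> (\<not> A \<subseteq> F \<or> F \<subseteq> M)} = {F. F \<subseteq> V \<and> (\<not> A' \<subseteq> F \<or> F \<subseteq> A')}"
    by (subst (asm) inj_on_image_eq_iff[OF convex_hull_inj_on[OF V]]) auto
  then show ?thesis
    using A' R by (intro that[of A']) (auto simp: set_eq_iff)
qed

text \<open>Two test faces refute a critical form \<open>A'\<close>: keeping \<open>A\<close> gives
  \<open>A' \<subset> A\<close>; adding to \<open>A'\<close> a vertex outside \<open>A\<close> gives
  a kept face, which therefore contains \<open>A\<close>, so that
  \<open>A \<subseteq> A'\<close>.\<close>

lemma regular_basic_tileI:
  fixes V :: "'a::euclidean_space set"
  assumes V: "\<not> affine_dependent V" "card V = n + 1" and A: "A \<subset> V" "A \<noteq> {}"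
  shows "regular_basic_tile n (tile V A {})"
proof -
  let ?R = "(\<lambda>a. convex hull (V - {a})) ` A"
  have "int n simplex (convex hull V)" using V by (auto simp: simplex_def)
  moreover have "?R \<subseteq> ridges (convex hull V)" using A by (auto simp: ridges_convex_hull[OF V(1)])
  ultimately have "basic_tile n (card ?R) (tile V A {})"
    unfolding basic_tile_def
    using deprive_eq_tile_basic[OF V(1) psubset_imp_subset[OF A(1)], symmetric] by blast
  moreover have False if crit: "critical_tile n k (tile V A {})" for k
  proof -
    obtain A' where A': "\<And>F. F \<subseteq> V \<Longrightarrow> A \<subseteq> F \<and> \<not> F \<subseteq> {} \<longleftrightarrow> A' \<subset> F"
      using critical_tile_cases[OF V(1) crit] by metis
    obtain v where v: "v \<in> V" "v \<notin> A" using A by blast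
    have "A' \<subset> A" using A A'[of A] by auto
    moreover from this v have "A \<subseteq> insert v A'" using A A'[of "insert v A'"] by auto
    ultimately show False using v by blast
  qed
  ultimately show ?thesis unfolding regular_basic_tile_def by blast
qed

text \<open>Codimension two provides two vertices \<open>v\<close>, \<open>w\<close> outside
  \<open>M\<close>. Adding either to \<open>A\<close> gives a kept face, so a critical form
  \<open>A'\<close> lies in both of these and hence in \<open>A\<close>. Then
  \<open>A' \<subset> M\<close>, and \<open>M\<close> would be kept.\<close>

lemma regular_morse_tileI:
  fixes V :: "'a::euclidean_space set"
  assumes V: "\<not> affine_dependent V" "card V = n + 1" and M: "M \<subseteq> V" "A \<subset> M" "card M + 1 \<le> n"
  shows "regular_morse_tile n (tile V A M)"
proof -
  have fin: "finite V" using V(1) by (rule aff_independent_finite)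
  have "morse_tile n (card A) (convex hull M) (tile V A M)"
    by (rule morse_tileI) (use V M in auto)
  moreover have False if crit: "critical_tile n k (tile V A M)" for k
  proof -
    obtain A' where A': "\<And>F. F \<subseteq> V \<Longrightarrow> A \<subseteq> F \<and> \<not> F \<subseteq> M \<longleftrightarrow> A' \<subset> F"
      using critical_tile_cases[OF V(1) crit] by metis
    have "\<not> card (V - M) \<le> Suc 0"
      using V M fin by (simp add: card_Diff_subset finite_subset)
    then obtain v w where vw: "v \<in> V - M" "w \<in> V - M" "v \<noteq> w"
      using fin by (auto simp: card_le_Suc0_iff_eq)
    have "A' \<subset> insert v A" "A' \<subset> insert w A"
      using A'[of "insert v A"] A'[of "insert w A"] vw M by auto
    then have "A' \<subseteq> A" using vw M by blast
    then show False using A'[of M] M by blast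
  qed
  ultimately show ?thesis unfolding regular_morse_tile_def by blast
qed

lemma isomorphic_tiles:
  fixes V :: "'a::euclidean_space set"
  assumes V: "\<not> affine_dependent V" and V': "\<not> affine_dependent V'" and f: "bij_betw f V V'"
    and "A \<subseteq> V" "M \<subseteq> V"
  shows "isomorphic_relative_simplices (tile V A M) (tile V' (f ` A) (f ` M))"
proof -
  have inj: "inj_on f V" and V'_eq: "V' = f ` V" using f by (auto simp: bij_betw_def)
  have sub: "f ` F \<subseteq> f ` G \<longleftrightarrow> F \<subseteq> G" if "F \<subseteq> V" "G \<subseteq> V" for F G
    using inj_on_image_subset_iff[OF inj that] .
  have "(\<lambda>F. convex hull (f ` vertices F)) ` (hull) convex ` {F. F \<subseteq> V \<and> (\<not> A \<subseteq> F \<or> F \<subseteq> M)}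
      = (\<lambda>F. convex hull (f ` F)) ` {F. F \<subseteq> V \<and> (\<not> A \<subseteq> F \<or> F \<subseteq> M)}"
    unfolding image_image
    by (rule image_cong) (auto simp: vertices_convex_hull[OF affine_independent_subset[OF V]])
  also have "\<dots> = (hull) convex ` (image f) ` {F. F \<subseteq> V \<and> (\<not> A \<subseteq> F \<or> F \<subseteq> M)}"
    by (simp add: image_image)
  also have "(image f) ` {F. F \<subseteq> V \<and> (\<not> A \<subseteq> F \<or> F \<subseteq> M)}
      = {F. F \<subseteq> V' \<and> (\<not> f ` A \<subseteq> F \<or> F \<subseteq> f ` M)}" (is "?l = ?r")
  proof
    show "?l \<subseteq> ?r" using assms sub by (auto simp: V'_eq)
    show "?r \<subseteq> ?l"
    proof
      fix F assume F: "F \<in> ?r"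
      then obtain G where "G \<subseteq> V" "F = f ` G" by (auto simp: V'_eq subset_image_iff)
      with F show "F \<in> ?l" using assms sub[of A G] sub[of G M] by auto
    qed
  qed
  finally show ?thesis
    unfolding isomorphic_relative_simplices_def underlying_tile removed_faces_tile
      vertices_convex_hull[OF V] vertices_convex_hull[OF V']
    using f by blast
qed

section \<open>Barycentric coordinates in a stellar subdivision\<close>

text \<open>\<open>SOME\<close> picks a whole function: its values are meaningful only on
  \<open>V\<close>, and only for \<open>x\<close> in the affine hull of \<open>V\<close>.\<close>

definition bary :: "'a::euclidean_space set \<Rightarrow> 'a \<Rightarrow> 'a \<Rightarrow> real" where
  "bary V x = (SOME u. sum u V = 1 \<and> (\<Sum>v\<in>V. u v *\<^sub>R v) = x)"

lemma bary_unique: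
  assumes V: "\<not> affine_dependent V" and u: "sum u V = 1" "(\<Sum>v\<in>V. u v *\<^sub>R v) = x" and v: "v \<in> V"
  shows "bary V x v = u v"
proof -
  have fin: "finite V" using V by (rule aff_independent_finite)
  have "sum (bary V x) V = 1 \<and> (\<Sum>v\<in>V. bary V x v *\<^sub>R v) = x"
    unfolding bary_def by (rule someI[of _ u]) (simp add: u)
  then have "sum (\<lambda>v. bary V x v - u v) V = 0" "(\<Sum>v\<in>V. (bary V x v - u v) *\<^sub>R v) = 0"
    using u by (simp_all add: sum_subtractf scaleR_left_diff_distrib)
  moreover have "\<not> (\<exists>U. sum U V = 0 \<and> (\<exists>v\<in>V. U v \<noteq> 0) \<and> (\<Sum>v\<in>V. U v *\<^sub>R v) = 0)"
    using V affine_dependent_explicit_finite[OF fin] by blast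
  ultimately have "bary V x v - u v = 0" using v by blast
  then show ?thesis by simp
qed

lemma bary_convex_hull:
  assumes V: "\<not> affine_dependent V" and x: "x \<in> convex hull V"
  shows "sum (bary V x) V = 1" "(\<Sum>v\<in>V. bary V x v *\<^sub>R v) = x" "v \<in> V \<Longrightarrow> 0 \<le> bary V x v"
proof -
  have fin: "finite V" using V by (rule aff_independent_finite)
  obtain u where u: "\<forall>v\<in>V. 0 \<le> u v" "sum u V = 1" "(\<Sum>v\<in>V. u v *\<^sub>R v) = x"
    using x by (auto simp: convex_hull_finite[OF fin])
  have eq: "bary V x v = u v" if "v \<in> V" for v
    by (rule bary_unique[OF V u(2,3) that])
  show "sum (bary V x) V = 1" using u(2) eq by simp
  show "(\<Sum>v\<in>V. bary V x v *\<^sub>R v) = x" using u(3) eq by simp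
  show "v \<in> V \<Longrightarrow> 0 \<le> bary V x v" using u(1) eq by simp
qed

lemma mem_convex_hull_iff_bary:
  assumes V: "\<not> affine_dependent V" and F: "F \<subseteq> V"
  shows "x \<in> convex hull F \<longleftrightarrow> x \<in> convex hull V \<and> {v \<in> V. 0 < bary V x v} \<subseteq> F"
proof
  have fin: "finite V" using V by (rule aff_independent_finite)
  have finF: "finite F" using F fin by (rule finite_subset)
  assume x: "x \<in> convex hull F"
  obtain u where u: "sum u F = 1" "(\<Sum>v\<in>F. u v *\<^sub>R v) = x"
    using x by (auto simp: convex_hull_finite[OF finF])
  \<comment> \<open>Coordinates with respect to \<open>F\<close>, extended by zero, are those with
    respect to \<open>V\<close>.\<close>
  let ?u = "\<lambda>v. if v \<in> F then u v else 0"
  have "sum ?u V = 1" "(\<Sum>v\<in>V. ?u v *\<^sub>R v) = x"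
    using u F fin by (simp_all add: if_distrib[of "\<lambda>c. c *\<^sub>R _"] sum.If_cases Int_absorb1
        cong: if_cong)
  from bary_unique[OF V this] have "bary V x v = 0" if "v \<in> V - F" for v
    using that by simp
  then show "x \<in> convex hull V \<and> {v \<in> V. 0 < bary V x v} \<subseteq> F"
    using x hull_mono[OF F] by force
next
  have fin: "finite V" using V by (rule aff_independent_finite)
  have finF: "finite F" using F fin by (rule finite_subset)
  assume x: "x \<in> convex hull V \<and> {v \<in> V. 0 < bary V x v} \<subseteq> F"
  have nonneg: "0 \<le> bary V x v" if "v \<in> V" for v
    using bary_convex_hull(3)[OF V] x that by blast
  have zero: "bary V x v = 0" if "v \<in> V - F" for v
    using x nonneg[of v] that by force
  have "sum (bary V x) F = sum (bary V x) V" "(\<Sum>v\<in>F. bary V x v *\<^sub>R v) = (\<Sum>v\<in>V. bary V x v *\<^sub>R v)"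
    using zero by (auto intro!: sum.mono_neutral_left fin F)
  then have "sum (bary V x) F = 1" "(\<Sum>v\<in>F. bary V x v *\<^sub>R v) = x"
    using bary_convex_hull(1,2)[OF V] x by auto
  moreover have "\<forall>v\<in>F. 0 \<le> bary V x v" using nonneg F by blast
  ultimately show "x \<in> convex hull F"
    unfolding convex_hull_finite[OF finF] by blast
qed

section \<open>Coordinates when the barycenter replaces a vertex\<close>

locale stellar_simplex =
  fixes V B :: "'a::euclidean_space set"
  assumes indep: "\<not> affine_dependent V" and B_subset: "B \<subseteq> V" and card_B: "2 \<le> card B"
begin

abbreviation b :: 'a where "b \<equiv> barycenter (convex hull B)"

lemma finite_V: "finite V" using indep by (rule aff_independent_finite)
lemma finite_B: "finite B" using B_subset finite_V by (rule finite_subset)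
lemma B_nonempty: "B \<noteq> {}" using card_B by auto

lemma barycenter_eq: "b = (1 / card B) *\<^sub>R \<Sum>B"
  using vertices_convex_hull[OF affine_independent_subset[OF indep B_subset]]
  by (simp add: barycenter_def inverse_eq_divide)

text \<open>A vertex has a single nonzero coordinate, while \<open>b\<close> has coordinate
  \<open>1 / card B\<close> at each vertex of \<open>B\<close>, and positive dimension gives at
  least two of them.\<close>

lemma barycenter_notin: "b \<notin> V"
proof
  assume b: "b \<in> V"
  let ?u = "\<lambda>v. if v \<in> B then 1 / card B else 0"
  have "sum ?u V = 1" "(\<Sum>v\<in>V. ?u v *\<^sub>R v) = b"
    using card_B B_subset finite_V
    by (simp_all add: if_distrib[of "\<lambda>c. c *\<^sub>R _"] sum.If_cases Int_absorb1 barycenter_eq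
        scaleR_sum_right cong: if_cong)
  note u = bary_unique[OF indep this]
  have "sum (\<lambda>v. if v = b then 1 else 0) V = (1::real)"
    "(\<Sum>v\<in>V. (if v = b then 1 else 0 :: real) *\<^sub>R v) = b"
    using b finite_V by (simp_all add: if_distrib[of "\<lambda>c. c *\<^sub>R _"] cong: if_cong)
  note w = bary_unique[OF indep this]
  have "v = b" if "v \<in> B" for v
    using u[of v] w[of v] that B_subset card_B by (auto split: if_splits)
  then have "card B \<le> card {b}" by (intro card_mono) auto
  then show False using card_B by simp
qed

text \<open>The coordinates with respect to \<open>V\<close> of the point with coordinates \<open>u\<close> in the simplex
  in which the barycenter replaces \<open>v\<close>.\<close>

definition pull :: "'a \<Rightarrow> ('a \<Rightarrow> real) \<Rightarrow> 'a \<Rightarrow> real" where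
  "pull v u w = (if w = v then 0 else u w) + (if w \<in> B then u b / card B else 0)"

text \<open>The weight of \<open>b\<close> is spread evenly over \<open>B\<close>. Since
  \<open>u\<close> is an arbitrary real function, this transports affine dependences (sum 0) as well
  as points (sum 1).\<close>

lemma sum_pull:
  assumes v: "v \<in> B"
  shows "sum (pull v u) V = sum u (insert b (V - {v}))"
    "(\<Sum>w\<in>V. pull v u w *\<^sub>R w) = (\<Sum>w\<in>insert b (V - {v}). u w *\<^sub>R w)"
proof -
  have "V \<inter> - {v} = V - {v}" by blast
  moreover have "V \<inter> {w. w \<noteq> v} = V - {v}" by blast
  ultimately show "sum (pull v u) V = sum u (insert b (V - {v}))"
    "(\<Sum>w\<in>V. pull v u w *\<^sub>R w) = (\<Sum>w\<in>insert b (V - {v}). u w *\<^sub>R w)"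
    using finite_V barycenter_notin B_subset card_B
    by (simp_all add: pull_def sum.distrib scaleR_add_left if_distrib[of "\<lambda>c. c *\<^sub>R _"]
        sum.If_cases Int_absorb1 barycenter_eq scaleR_sum_right cong: if_cong)
qed

lemma indep_replace:
  assumes v: "v \<in> B"
  shows "\<not> affine_dependent (insert b (V - {v}))"
proof
  assume "affine_dependent (insert b (V - {v}))"
  then obtain U where U: "sum U (insert b (V - {v})) = 0" "(\<Sum>w\<in>insert b (V - {v}). U w *\<^sub>R w) = 0"
    "\<exists>w\<in>insert b (V - {v}). U w \<noteq> 0"
    using affine_dependent_explicit_finite[of "insert b (V - {v})"] finite_V by auto
  have "sum (pull v U) V = 0" "(\<Sum>w\<in>V. pull v U w *\<^sub>R w) = 0"
    using U sum_pull[OF v] by simp_all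
  then have zero: "pull v U w = 0" if "w \<in> V" for w
    using indep affine_dependent_explicit_finite[OF finite_V] that by blast
  \<comment> \<open>At \<open>v\<close> only the share of \<open>b\<close> remains:
    \<open>pull v U v = U b / card B\<close>.\<close>
  have "U b = 0" using zero[of v] v B_subset card_B by (auto simp: pull_def)
  moreover have "U w = 0" if "w \<in> V - {v}" for w
    using zero[of w] that \<open>U b = 0\<close> by (simp add: pull_def split: if_splits)
  ultimately show False using U(3) by auto
qed

lemma card_replace: "v \<in> B \<Longrightarrow> card (insert b (V - {v})) = card V"
  using card_Suc_Diff1[OF finite_V, of v] finite_V barycenter_notin B_subset by auto

text \<open>\<open>card B * low x\<close> is the coordinate of \<open>x\<close> at \<open>b\<close>
  in every simplex that has \<open>b\<close> in place of a vertex of \<open>B\<close> and contains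
  \<open>x\<close>.\<close>

definition low :: "'a \<Rightarrow> real" where "low x = Min (bary V x ` B)"

text \<open>The vertices of the smallest simplex containing \<open>x\<close>, before and after the subdivision.\<close>

definition supp :: "'a \<Rightarrow> 'a set" where "supp x = {v \<in> V. 0 < bary V x v}"

definition ssupp :: "'a \<Rightarrow> 'a set" where
  "ssupp x = {v \<in> V. (if v \<in> B then low x else 0) < bary V x v} \<union> (if 0 < low x then {b} else {})"

lemma low_le: "v \<in> B \<Longrightarrow> low x \<le> bary V x v"
  using finite_B by (simp add: low_def)

lemma low_attained: obtains v where "v \<in> B" "bary V x v = low x"
proof -
  have "low x \<in> bary V x ` B" unfolding low_def using finite_B B_nonempty by (intro Min_in) auto
  then show ?thesis using that by auto
qed

lemma low_nonneg: "x \<in> convex hull V \<Longrightarrow> 0 \<le> low x"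
  by (metis low_attained bary_convex_hull(3)[OF indep] B_subset subsetD)

lemma ssupp_subset: "ssupp x \<subseteq> insert b V" by (auto simp: ssupp_def)

text \<open>A vertex attaining the minimum drops out. Hence \<open>ssupp x\<close> is a simplex of
  the subdivision, and every point is attributed to some piece.\<close>

lemma not_B_subset_ssupp: "\<not> B \<subseteq> ssupp x"
proof -
  obtain v where "v \<in> B" "bary V x v = low x" by (rule low_attained)
  then have "v \<notin> ssupp x" using barycenter_notin B_subset by (auto simp: ssupp_def)
  with \<open>v \<in> B\<close> show ?thesis by blast
qed

text \<open>\<open>b\<close> has positive weight exactly when all coordinates over \<open>B\<close>
  are positive, and then the whole of \<open>B\<close> belongs to the support.\<close>

lemma supp_eq_ssupp:
  assumes "x \<in> convex hull V"
  shows "supp x = (if b \<in> ssupp x then ssupp x - {b} \<union> B else ssupp x)"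
proof -
  have b: "b \<in> ssupp x \<longleftrightarrow> 0 < low x" using barycenter_notin by (auto simp: ssupp_def)
  show ?thesis
  proof (cases "0 < low x")
    case True
    then have "0 < bary V x v" if "v \<in> B" for v
      using low_le[OF that, of x] by simp
    with True b barycenter_notin B_subset show ?thesis
      by (fastforce simp: supp_def ssupp_def split: if_splits)
  next
    case False
    with low_nonneg[OF assms] have "low x = 0" by simp
    with b barycenter_notin show ?thesis by (simp add: supp_def ssupp_def)
  qed
qed

lemma supp_nonempty: "x \<in> convex hull V \<Longrightarrow> supp x \<noteq> {}"
  using mem_convex_hull_iff_bary[OF indep, of "{}" x] by (auto simp: supp_def)

lemma ssupp_nonempty: "x \<in> convex hull V \<Longrightarrow> ssupp x \<noteq> {}"
  using supp_nonempty[of x] supp_eq_ssupp[of x] by (auto split: if_splits)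

text \<open>The right side does not mention \<open>v\<close> beyond \<open>G\<close>, so faces of
  different simplices of the subdivision can be compared through the single set
  \<open>ssupp x\<close>. The proof converts coordinates with \<open>pull v\<close> in one direction
  and with its inverse in the other.\<close>

lemma mem_replace_iff:
  assumes v: "v \<in> B" and G: "G \<subseteq> insert b (V - {v})"
  shows "x \<in> convex hull G \<longleftrightarrow> x \<in> convex hull V \<and> ssupp x \<subseteq> G"
proof
  let ?V = "insert b (V - {v})"
  note iff = mem_convex_hull_iff_bary[OF indep_replace[OF v] G]
  assume "x \<in> convex hull G"
  then have x: "x \<in> convex hull ?V" "{w \<in> ?V. 0 < bary ?V x w} \<subseteq> G" using iff by auto
  let ?u = "bary ?V x"
  note u = bary_convex_hull[OF indep_replace[OF v] x(1)]
  have pull: "bary V x w = pull v ?u w" if "w \<in> V" for w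
    by (rule bary_unique[OF indep _ _ that]) (simp_all only: sum_pull[OF v] u(1,2))
  have ub: "0 \<le> ?u b" by (rule u(3)) simp
  have nonneg: "0 \<le> pull v ?u w" if "w \<in> V" for w
    using that u(3)[of w] ub by (auto simp: pull_def)
  have "sum (pull v ?u) V = 1" "(\<Sum>w\<in>V. pull v ?u w *\<^sub>R w) = x"
    using u by (simp_all only: sum_pull[OF v])
  then have xV: "x \<in> convex hull V"
    unfolding convex_hull_finite[OF finite_V] using nonneg by blast
  \<comment> \<open>The vertex \<open>v\<close> receives nothing but its share of \<open>b\<close>;
    every other vertex of \<open>B\<close> receives at least as much.\<close>
  have "low x = ?u b / card B"
    unfolding low_def
  proof (rule Min_eqI)
    show "?u b / card B \<in> bary V x ` B"
      using v B_subset pull[of v] by (force simp: pull_def)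
    show "?u b / card B \<le> y" if y: "y \<in> bary V x ` B" for y
    proof -
      obtain w where w: "w \<in> B" "y = bary V x w" using y by blast
      then have "y = pull v ?u w" using pull B_subset by blast
      moreover have "w = v \<or> 0 \<le> ?u w" using u(3)[of w] w B_subset by blast
      ultimately show ?thesis using w(1) by (auto simp: pull_def)
    qed
  qed (simp add: finite_B)
  moreover have "card B > 0" using card_B by simp
  ultimately have "ssupp x \<subseteq> {w \<in> ?V. 0 < ?u w}"
    using pull v by (auto simp: ssupp_def pull_def zero_less_divide_iff split: if_splits)
  then show "x \<in> convex hull V \<and> ssupp x \<subseteq> G" using xV x(2) by blast
next
  let ?V = "insert b (V - {v})"
  note iff = mem_convex_hull_iff_bary[OF indep_replace[OF v] G]
  have fin: "finite ?V" using finite_V by simp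
  assume asm: "x \<in> convex hull V \<and> ssupp x \<subseteq> G"
  then have x: "x \<in> convex hull V" by blast
  note c = bary_convex_hull[OF indep x]
  \<comment> \<open>\<open>G\<close> misses \<open>v\<close>, so \<open>v\<close> attains the
    minimum over \<open>B\<close>.\<close>
  have "v \<notin> ssupp x" using asm G v B_subset barycenter_notin by blast
  then have lowv: "bary V x v = low x"
    using v B_subset low_le[OF v, of x] by (force simp: ssupp_def)
  \<comment> \<open>This inverts \<open>pull v\<close>: the common amount \<open>low x\<close> is
    taken from each vertex of \<open>B\<close> and collected at \<open>b\<close>, which leaves
    nothing at \<open>v\<close>.\<close>
  let ?u = "\<lambda>w. if w = b then card B * low x else bary V x w - (if w \<in> B then low x else 0)"
  have pos: "card B > 0" using card_B by simp
  have pull: "pull v ?u w = bary V x w" if "w \<in> V" for w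
    using that lowv v pos barycenter_notin by (auto simp: pull_def)
  have "sum ?u ?V = 1" "(\<Sum>w\<in>?V. ?u w *\<^sub>R w) = x"
    using c(1,2) pull by (simp_all only: sum_pull[OF v, symmetric] cong: sum.cong)
  note u = this bary_unique[OF indep_replace[OF v] this]
  have nonneg: "0 \<le> ?u w" if "w \<in> ?V" for w
    using that c(3)[of w] low_le[of w x] low_nonneg[OF x] by auto
  have i: "x \<in> convex hull ?V"
    unfolding convex_hull_finite[OF fin] by (intro CollectI exI[of _ ?u] conjI ballI nonneg u(1,2))
  have ii: "{w \<in> ?V. 0 < ?u w} \<subseteq> ssupp x"
    using pos barycenter_notin by (auto simp: ssupp_def zero_less_mult_iff split: if_splits)
  have iii: "{w \<in> ?V. 0 < bary ?V x w} = {w \<in> ?V. 0 < ?u w}"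
    using u(3) by (intro Collect_cong conj_cong) auto
  show "x \<in> convex hull G"
    unfolding iff iii using i order_trans[OF ii conjunct2[OF asm]] by (rule conjI)
qed

end

section \<open>The stellar subdivision\<close>

context stellar_simplex
begin

text \<open>Vertices of the smallest face of the original simplex containing the simplex spanned by \<open>G\<close>.\<close>

definition coarse :: "'a set \<Rightarrow> 'a set" where
  "coarse G = (if b \<in> G then G - {b} \<union> B else G)"

text \<open>The vertex-set form of \<open>stellar\<close>, treating old simplices and cones alike:
  for \<open>G\<close> without \<open>b\<close>, \<open>coarse G\<close> is \<open>G\<close> itself;
  for a cone, it is the smallest face containing both its base and the subdivided face.\<close>

definition st :: "'a set set \<Rightarrow> 'a set set" where
  "st \<L> = {G. G \<subseteq> insert b V \<and> \<not> B \<subseteq> G \<and> coarse G \<in> \<L>}"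

lemma coarse_mono: "F \<subseteq> G \<Longrightarrow> coarse F \<subseteq> coarse G"
  by (auto simp: coarse_def)

lemma coarse_subset: "G \<subseteq> insert b V \<Longrightarrow> coarse G \<subseteq> V"
  using B_subset by (auto simp: coarse_def)

lemma supp_coarse: "x \<in> convex hull V \<Longrightarrow> supp x = coarse (ssupp x)"
  by (simp add: supp_eq_ssupp coarse_def)

lemma st_cases:
  assumes "G \<in> st \<L>"
  obtains v where "v \<in> B" "G \<subseteq> insert b (V - {v})"
  using assms by (auto simp: st_def)

lemma mem_st_iff: "G \<in> st \<L> \<Longrightarrow> x \<in> convex hull G \<longleftrightarrow> x \<in> convex hull V \<and> ssupp x \<subseteq> G"
  by (metis st_cases mem_replace_iff)

lemma indep_st: "G \<in> st \<L> \<Longrightarrow> \<not> affine_dependent G"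
  by (metis st_cases indep_replace affine_independent_subset)

lemma st_downward:
  assumes "\<forall>G\<in>\<L>. Pow G \<subseteq> \<L>" "G \<in> st \<L>" "F \<subseteq> G"
  shows "F \<in> st \<L>"
  using assms coarse_mono[of F G] unfolding st_def by blast

text \<open>Membership in a simplex is inclusion of \<open>ssupp x\<close> in its vertex set, so two
  hulls meet in the hull of the common vertices even if no simplex of the subdivision contains
  both.\<close>

lemma simplicial_complex_st:
  assumes "\<forall>G\<in>\<L>. Pow G \<subseteq> \<L>"
  shows "simplicial_complex ((hull) convex ` st \<L>)"
proof -
  have face: "F face_of convex hull G \<longleftrightarrow> (\<exists>H\<subseteq>G. F = convex hull H)" if "G \<in> st \<L>" for F G
    using face_of_convex_hull_affine_independent[OF indep_st[OF that]] by blast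
  have "finite (st \<L>)"
    by (rule finite_subset[of _ "Pow (insert b V)"]) (auto simp: st_def finite_V)
  moreover have "\<exists>n. n simplex convex hull G" if "G \<in> st \<L>" for G
    using simplex_convex_hull[of G "int (card G) - 1"] indep_st[OF that] by auto
  moreover have "F \<in> (hull) convex ` st \<L>" if G: "G \<in> st \<L>" "F face_of convex hull G" for F G
  proof -
    obtain H where "H \<subseteq> G" "F = convex hull H" using G(2) unfolding face[OF G(1)] by blast
    then show ?thesis using st_downward[OF assms G(1)] by blast
  qed
  moreover have "convex hull F \<inter> convex hull G face_of convex hull F" if "F \<in> st \<L>" "G \<in> st \<L>" for F G
  proof -
    have FG: "F \<inter> G \<in> st \<L>" using st_downward[OF assms that(1)] by blast
    have "convex hull F \<inter> convex hull G = convex hull (F \<inter> G)"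
      by (rule set_eqI) (simp only: Int_iff mem_st_iff[OF FG] mem_st_iff[OF that(1)]
          mem_st_iff[OF that(2)] le_inf_iff, blast)
    then show ?thesis using face[OF that(1)] by blast
  qed
  ultimately show ?thesis unfolding simplicial_complex_def by (auto 0 0)
qed

text \<open>Subdividing does not change the realization: \<open>ssupp x\<close> always meets the
  first two conditions of \<open>st\<close>, and its coarsening is \<open>supp x\<close>.\<close>

lemma Union_st:
  assumes "\<forall>G\<in>\<L>. Pow G \<subseteq> \<L>"
  shows "\<Union> ((hull) convex ` st \<L>) = {x \<in> convex hull V. supp x \<in> \<L>}"
proof (intro set_eqI iffI)
  fix x assume "x \<in> \<Union> ((hull) convex ` st \<L>)"
  then obtain G where G: "G \<in> st \<L>" "x \<in> convex hull G" by blast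
  then have "x \<in> convex hull V" "ssupp x \<subseteq> G" using mem_st_iff by blast+
  moreover from this have "supp x \<subseteq> coarse G" using supp_coarse coarse_mono by metis
  ultimately show "x \<in> {x \<in> convex hull V. supp x \<in> \<L>}"
    using assms G(1) by (auto simp: st_def)
next
  fix x assume x: "x \<in> {x \<in> convex hull V. supp x \<in> \<L>}"
  then have "ssupp x \<in> st \<L>"
    using not_B_subset_ssupp ssupp_subset supp_coarse by (auto simp: st_def)
  moreover from this x have "x \<in> convex hull ssupp x" using mem_st_iff by blast
  ultimately show "x \<in> \<Union> ((hull) convex ` st \<L>)" by blast
qed

text \<open>By downward closure, the simplex \<open>\<sigma>\<close> in the definition of
  \<open>stellar\<close> may be taken minimal, spanned by \<open>F \<union> B\<close> where
  \<open>F\<close> spans \<open>\<rho>\<close>.\<close>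

lemma stellar_eq_st:
  assumes sub: "\<L> \<subseteq> Pow V" and down: "\<forall>G\<in>\<L>. Pow G \<subseteq> \<L>"
  shows "stellar (convex hull B) ((hull) convex ` \<L>) = (hull) convex ` st \<L>"
proof -
  have B_sub: "convex hull B \<subseteq> convex hull G \<longleftrightarrow> B \<subseteq> G" if "G \<subseteq> V" for G
    by (rule convex_hull_subset_iff[OF indep B_subset that])
  have eq1: "{\<sigma> \<in> (hull) convex ` \<L>. \<not> convex hull B \<subseteq> \<sigma>} = (hull) convex ` {G \<in> \<L>. \<not> B \<subseteq> G}"
  proof -
    have "{G \<in> \<L>. \<not> B \<subseteq> G} = {G \<in> \<L>. \<not> convex hull B \<subseteq> convex hull G}"
      by (intro Collect_cong conj_cong refl arg_cong[of _ _ Not] B_sub[symmetric]) (use sub in blast)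
    then show ?thesis by (simp only:) blast
  qed
  have eq2: "{convex hull (insert b \<rho>) | \<rho>. \<not> convex hull B \<subseteq> \<rho> \<and>
        (\<exists>\<sigma>\<in>(hull) convex ` \<L>. convex hull B \<subseteq> \<sigma> \<and> \<rho> face_of \<sigma>)}
      = (hull) convex ` {insert b F | F. F \<subseteq> V \<and> \<not> B \<subseteq> F \<and> F \<union> B \<in> \<L>}" (is "?l = ?r")
  proof
    show "?l \<subseteq> ?r"
    proof
      fix x assume "x \<in> ?l"
      then obtain \<rho> H where x: "x = convex hull (insert b \<rho>)" and \<rho>: "\<not> convex hull B \<subseteq> \<rho>"
        and H: "H \<in> \<L>" "convex hull B \<subseteq> convex hull H" "\<rho> face_of convex hull H" by blast
      have HV: "H \<subseteq> V" using H sub by blast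
      obtain F where F: "F \<subseteq> H" "\<rho> = convex hull F"
        using H(3) face_of_convex_hull_affine_independent[OF affine_independent_subset[OF indep HV]]
        by blast
      have "x = convex hull (insert b F)"
        unfolding x F(2) by (rule hull_insert[symmetric])
      moreover have "\<not> B \<subseteq> F" using \<rho> F hull_mono by blast
      moreover have "F \<union> B \<in> \<L>" using down H(1) F(1) H(2)[unfolded B_sub[OF HV]] by blast
      ultimately show "x \<in> ?r" using F HV by blast
    qed
    show "?r \<subseteq> ?l"
    proof
      fix x assume "x \<in> ?r"
      then obtain F where F: "x = convex hull (insert b F)" "F \<subseteq> V" "\<not> B \<subseteq> F" "F \<union> B \<in> \<L>" by blast
      have HV: "F \<union> B \<subseteq> V" using F B_subset by blast
      have "x = convex hull (insert b (convex hull F))"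
        unfolding F(1) by (rule hull_insert)
      moreover have "convex hull F face_of convex hull (F \<union> B)"
        using face_of_convex_hull_affine_independent[OF affine_independent_subset[OF indep HV]] by blast
      moreover have "convex hull B \<subseteq> convex hull (F \<union> B)" by (intro hull_mono) blast
      moreover have "\<not> convex hull B \<subseteq> convex hull F" using B_sub[OF F(2)] F(3) by blast
      ultimately show "x \<in> ?l" using F(4) by blast
    qed
  qed
  have "st \<L> = {G \<in> \<L>. \<not> B \<subseteq> G} \<union> {insert b F | F. F \<subseteq> V \<and> \<not> B \<subseteq> F \<and> F \<union> B \<in> \<L>}"
  proof (intro set_eqI iffI)
    fix G assume G: "G \<in> st \<L>"
    show "G \<in> {G \<in> \<L>. \<not> B \<subseteq> G} \<union> {insert b F | F. F \<subseteq> V \<and> \<not> B \<subseteq> F \<and> F \<union> B \<in> \<L>}"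
    proof (cases "b \<in> G")
      case True
      then have "G = insert b (G - {b})" "G - {b} \<subseteq> V" "\<not> B \<subseteq> G - {b}" "G - {b} \<union> B \<in> \<L>"
        using G by (auto simp: st_def coarse_def)
      then show ?thesis by blast
    qed (use G in \<open>auto simp: st_def coarse_def\<close>)
  next
    fix G assume "G \<in> {G \<in> \<L>. \<not> B \<subseteq> G} \<union> {insert b F | F. F \<subseteq> V \<and> \<not> B \<subseteq> F \<and> F \<union> B \<in> \<L>}"
    then show "G \<in> st \<L>"
    proof
      assume "G \<in> {G \<in> \<L>. \<not> B \<subseteq> G}"
      moreover from this have "b \<notin> G" using barycenter_notin sub by blast
      ultimately show ?thesis using sub by (auto simp: st_def coarse_def)
    next
      assume "G \<in> {insert b F | F. F \<subseteq> V \<and> \<not> B \<subseteq> F \<and> F \<union> B \<in> \<L>}"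
      then obtain F where F: "G = insert b F" "F \<subseteq> V" "\<not> B \<subseteq> F" "F \<union> B \<in> \<L>" by blast
      then have "b \<notin> F" "b \<notin> B" using barycenter_notin B_subset by blast+
      then show ?thesis using F by (auto simp: st_def coarse_def)
    qed
  qed
  then show ?thesis
    unfolding stellar_def eq1 eq2 by (simp only: image_Un)
qed

section \<open>The subdivided tile\<close>

abbreviation removed :: "'a set \<Rightarrow> 'a set \<Rightarrow> 'a set set" where
  "removed A M \<equiv> {F. F \<subseteq> V \<and> (\<not> A \<subseteq> F \<or> F \<subseteq> M)}"

text \<open>Both branches of \<open>relative_stellar\<close> are given by \<open>st\<close>: if
  \<open>B\<close> itself is not removed, then by downward closure no removed face contains
  \<open>B\<close>, and \<open>st\<close> changes nothing.\<close>

lemma relative_stellar_tile: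
  "relative_stellar (convex hull B) (complex_of (tile V A M))
    = ((hull) convex ` st (Pow V), (hull) convex ` st (removed A M))"
proof -
  have 1: "stellar (convex hull B) ((hull) convex ` Pow V) = (hull) convex ` st (Pow V)"
    by (rule stellar_eq_st) auto
  have 2: "stellar (convex hull B) ((hull) convex ` removed A M) = (hull) convex ` st (removed A M)"
    by (rule stellar_eq_st) auto
  have mem: "convex hull B \<in> (hull) convex ` removed A M \<longleftrightarrow> B \<in> removed A M"
    using B_subset by (intro inj_on_image_mem_iff[OF convex_hull_inj_on[OF indep]]) auto
  have "st (removed A M) = removed A M" if "B \<notin> removed A M"
  proof (intro set_eqI iffI)
    fix G assume G: "G \<in> st (removed A M)"
    then have *: "coarse G \<in> removed A M" by (simp add: st_def)
    have "b \<notin> G"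
    proof
      assume "b \<in> G"
      then have "B \<subseteq> coarse G" by (simp add: coarse_def)
      with * that show False by blast
    qed
    then have "coarse G = G" by (simp add: coarse_def)
    with * show "G \<in> removed A M" by (simp only:)
  next
    fix G assume G: "G \<in> removed A M"
    then have "b \<notin> G" using barycenter_notin by blast
    then have "coarse G = G" by (simp add: coarse_def)
    moreover have "\<not> B \<subseteq> G" using that G by blast
    ultimately show "G \<in> st (removed A M)" using G by (auto simp: st_def)
  qed
  then show ?thesis
    unfolding relative_stellar_def complex_of_def fst_conv snd_conv underlying_tile
      removed_faces_tile faces_convex_hull[OF indep] 1 2 mem by simp
qed

lemma is_relative_complex_stellar:
  "is_relative_complex (relative_stellar (convex hull B) (complex_of (tile V A M)))"
proof -
  have "st (removed A M) \<subseteq> st (Pow V)" by (auto simp: st_def)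
  moreover have "simplicial_complex ((hull) convex ` st (Pow V))"
    by (rule simplicial_complex_st) auto
  moreover have "simplicial_complex ((hull) convex ` st (removed A M))"
    by (rule simplicial_complex_st) auto
  ultimately show ?thesis
    unfolding is_relative_complex_def relative_stellar_tile fst_conv snd_conv by (intro conjI image_mono)
qed

lemma realization_stellar:
  "realization (relative_stellar (convex hull B) (complex_of (tile V A M)))
    = {x \<in> convex hull V. A \<subseteq> supp x \<and> \<not> supp x \<subseteq> M}"
proof -
  have "\<Union> ((hull) convex ` st (Pow V)) = {x \<in> convex hull V. supp x \<in> Pow V}"
    by (rule Union_st) auto
  moreover have "\<Union> ((hull) convex ` st (removed A M)) = {x \<in> convex hull V. supp x \<in> removed A M}"
    by (rule Union_st) auto
  ultimately show ?thesis
    unfolding realization_def relative_stellar_tile fst_conv snd_conv by (auto simp: supp_def)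
qed

lemma mem_replace_iff_notin:
  "v \<in> B \<Longrightarrow> x \<in> convex hull (insert b (V - {v})) \<longleftrightarrow> x \<in> convex hull V \<and> v \<notin> ssupp x"
  using mem_replace_iff[of v "insert b (V - {v})" x] ssupp_subset[of x] barycenter_notin B_subset
  by blast

lemma simplex_realization_replace:
  assumes v: "v \<in> B"
  shows "simplex_realization (tile (insert b (V - {v})) A M)
    = {x \<in> convex hull V. v \<notin> ssupp x \<and> A \<subseteq> ssupp x \<and> \<not> ssupp x \<subseteq> M}"
proof (intro set_eqI iffI)
  fix x assume x: "x \<in> simplex_realization (tile (insert b (V - {v})) A M)"
  then have "x \<in> convex hull (insert b (V - {v}))" by simp
  then have xV: "x \<in> convex hull V" "v \<notin> ssupp x" using mem_replace_iff_notin[OF v] by auto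
  then have sub: "ssupp x \<subseteq> insert b (V - {v})" using ssupp_subset[of x] by blast
  then have "x \<in> convex hull ssupp x" using mem_replace_iff[OF v sub] xV by blast
  with x sub have "A \<subseteq> ssupp x \<and> \<not> ssupp x \<subseteq> M"
    unfolding removed_faces_tile by blast
  with xV show "x \<in> {x \<in> convex hull V. v \<notin> ssupp x \<and> A \<subseteq> ssupp x \<and> \<not> ssupp x \<subseteq> M}" by blast
next
  fix x assume x: "x \<in> {x \<in> convex hull V. v \<notin> ssupp x \<and> A \<subseteq> ssupp x \<and> \<not> ssupp x \<subseteq> M}"
  then have "x \<in> convex hull (insert b (V - {v}))" using mem_replace_iff_notin[OF v] by blast
  moreover have "x \<notin> convex hull G"
    if "G \<subseteq> insert b (V - {v})" "\<not> A \<subseteq> G \<or> G \<subseteq> M" for G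
    using mem_replace_iff[OF v that(1)] x that(2) by blast
  ultimately show "x \<in> simplex_realization (tile (insert b (V - {v})) A M)"
    unfolding removed_faces_tile by auto
qed

end

section \<open>The shelling\<close>

text \<open>\<open>A_first\<close> says that all of \<open>A \<inter> B\<close> precedes any vertex
  outside \<open>A\<close>. The order is otherwise free and is fixed only in the cases of the
  theorem.\<close>

locale stellar_tile = stellar_simplex V B for V B :: "'a::euclidean_space set" +
  fixes A M :: "'a set" and vs :: "'a list" and n :: nat
  assumes card_V: "card V = n + 1" and A_subset: "A \<subseteq> V" and M_subset: "M \<subseteq> V"
    and morse: "M = {} \<or> A \<subseteq> M \<and> card M + 1 \<le> n"
    and distinct_vs: "distinct vs" and set_vs: "set vs = B"
    and A_first: "i < length vs \<Longrightarrow> vs ! i \<notin> A \<Longrightarrow> A \<inter> B \<subseteq> set (take i vs)"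
begin

abbreviation verts :: "nat \<Rightarrow> 'a set" where "verts i \<equiv> insert b (V - {vs ! i})"

definition opp :: "nat \<Rightarrow> 'a set" where
  "opp i = set (take i vs) \<union> (A - B) \<union> (if vs ! i \<in> A then {b} else {})"

definition pre_morse :: "nat \<Rightarrow> 'a set" where
  "pre_morse i = (if B \<subseteq> M then insert b (M - {vs ! i}) else M - {vs ! i})"

text \<open>Once \<open>opp i\<close> is not contained in it, removing the face spanned by \<open>pre_morse i\<close> has no effect.\<close>

definition morse_verts :: "nat \<Rightarrow> 'a set" where
  "morse_verts i = (if opp i \<subseteq> pre_morse i then pre_morse i else {})"

definition piece :: "nat \<Rightarrow> 'a relative_simplex" where
  "piece i = tile (verts i) (opp i) (morse_verts i)"

definition pieces :: "'a relative_simplex list" where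
  "pieces = map piece [0..<length vs]"

lemma length_vs: "length vs = card B"
  using distinct_card[OF distinct_vs] set_vs by simp

lemma nth_in_B: "i < length vs \<Longrightarrow> vs ! i \<in> B"
  using set_vs by auto

lemma nth_in_take_iff: "i < length vs \<Longrightarrow> j \<le> length vs \<Longrightarrow> vs ! i \<in> set (take j vs) \<longleftrightarrow> i < j"
  using distinct_vs by (auto simp: in_set_conv_nth nth_eq_iff_index_eq)

lemma set_take_subset_B: "set (take i vs) \<subseteq> B"
  using set_take_subset[of i vs] set_vs by simp

lemma indep_verts: "i < length vs \<Longrightarrow> \<not> affine_dependent (verts i)"
  using indep_replace nth_in_B by blast

lemma card_verts: "i < length vs \<Longrightarrow> card (verts i) = n + 1"
  using card_replace nth_in_B card_V by simp

lemma opp_subset: "i < length vs \<Longrightarrow> opp i \<subseteq> verts i"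
  using nth_in_take_iff[of i i] set_take_subset_B[of i] B_subset A_subset nth_in_B[of i]
  by (auto simp: opp_def)

lemma morse_verts_subset: "morse_verts i \<subseteq> verts i"
  using M_subset by (auto simp: morse_verts_def pre_morse_def)

text \<open>If \<open>b\<close> enters, then \<open>vs ! i\<close> leaves, so the Morse face still
  has codimension at least two.\<close>

lemma card_pre_morse: "i < length vs \<Longrightarrow> card (pre_morse i) \<le> card M"
proof -
  assume i: "i < length vs"
  have fin: "finite M" using M_subset finite_V by (rule finite_subset)
  show ?thesis
  proof (cases "B \<subseteq> M")
    case True
    then have "vs ! i \<in> M" using nth_in_B[OF i] by blast
    then show ?thesis
      using True card_Suc_Diff1[OF fin, of "vs ! i"] card_insert_le_m1[of "card M" "M - {vs ! i}" b] fin
      by (cases "card M") (auto simp: pre_morse_def card_insert_if)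
  next
    case False
    then show ?thesis by (simp add: pre_morse_def card_mono[OF fin])
  qed
qed

lemma pre_morse_empty: "i < length vs \<Longrightarrow> M = {} \<Longrightarrow> pre_morse i = {}"
  unfolding pre_morse_def using B_nonempty by simp

lemma morse_verts_cases:
  assumes i: "i < length vs"
  shows "morse_verts i = {} \<or> opp i \<subseteq> morse_verts i \<and> card (morse_verts i) + 1 \<le> n"
proof (cases "morse_verts i = {}")
  case False
  then have *: "opp i \<subseteq> pre_morse i" "morse_verts i = pre_morse i"
    unfolding morse_verts_def by presburger+
  with False pre_morse_empty[OF i] morse have "card M + 1 \<le> n" by metis
  with * card_pre_morse[OF i] show ?thesis by simp
qed simp

lemma morse_tile_piece:
  assumes i: "i < length vs"
  shows "morse_tile n (card (opp i)) (convex hull (morse_verts i)) (piece i)"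
  unfolding piece_def
  using indep_verts[OF i] card_verts[OF i] opp_subset[OF i] morse_verts_subset[of i]
    morse_verts_cases[OF i] by (rule morse_tileI)

lemma morse_verts_psubset: "i < length vs \<Longrightarrow> morse_verts i \<subset> verts i"
  using morse_verts_subset[of i] morse_verts_cases[of i] card_verts[of i] by auto

lemma is_relative_simplex_piece: "i < length vs \<Longrightarrow> is_relative_simplex (piece i)"
  unfolding piece_def
  by (rule is_relative_simplex_tile[OF indep_verts card_verts opp_subset morse_verts_psubset])

lemma piece_mem_iff:
  assumes i: "i < length vs" and G: "G \<noteq> {}" "vs ! i \<notin> G"
  shows "opp i \<subseteq> G \<and> \<not> G \<subseteq> morse_verts i
    \<longleftrightarrow> set (take i vs) \<subseteq> G \<and> A \<subseteq> coarse G \<and> \<not> coarse G \<subseteq> M"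
proof -
  have bB: "b \<notin> B" "b \<notin> A" "b \<notin> M"
    using barycenter_notin B_subset A_subset M_subset by blast+
  have v: "vs ! i \<in> B" by (rule nth_in_B[OF i])
  have 1: "opp i \<subseteq> G \<longleftrightarrow> set (take i vs) \<subseteq> G \<and> A \<subseteq> coarse G"
  proof (cases "vs ! i \<in> A")
    case True
    then show ?thesis using bB G v by (auto simp: opp_def coarse_def)
  next
    case False
    with A_first[OF i] have "A \<inter> B \<subseteq> set (take i vs)" by blast
    moreover have "G - {b} \<subseteq> coarse G" "coarse G \<subseteq> G \<union> B" by (auto simp: coarse_def)
    moreover have "opp i = set (take i vs) \<union> (A - B)" using False by (simp add: opp_def)
    ultimately show ?thesis using bB by blast
  qed
  \<comment> \<open>If \<open>opp i\<close> is not inside \<open>pre_morse i\<close>, then neither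
    is \<open>G\<close>; being nonempty, \<open>G\<close> is not inside the default
    \<open>{}\<close> either.\<close>
  have 2: "G \<subseteq> morse_verts i \<longleftrightarrow> G \<subseteq> pre_morse i" if "opp i \<subseteq> G"
    using that G by (auto simp: morse_verts_def)
  have 3: "G \<subseteq> pre_morse i \<longleftrightarrow> coarse G \<subseteq> M"
    using bB G v by (auto simp: pre_morse_def coarse_def)
  show ?thesis using 1 2 3 by blast
qed

text \<open>A vertex of \<open>B\<close> is missing from \<open>ssupp x\<close> iff it attains the
  minimum, so these are the points whose first minimizing vertex is \<open>vs ! i\<close>.\<close>

lemma simplex_realization_piece:
  assumes i: "i < length vs"
  shows "simplex_realization (piece i)
    = {x \<in> realization (relative_stellar (convex hull B) (complex_of (tile V A M))).
        vs ! i \<notin> ssupp x \<and> set (take i vs) \<subseteq> ssupp x}"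
proof (rule set_eqI)
  fix x
  have "x \<in> simplex_realization (piece i)
    \<longleftrightarrow> x \<in> convex hull V \<and> vs ! i \<notin> ssupp x \<and> (opp i \<subseteq> ssupp x \<and> \<not> ssupp x \<subseteq> morse_verts i)"
    unfolding piece_def simplex_realization_replace[OF nth_in_B[OF i]] by blast
  also have "\<dots> \<longleftrightarrow> x \<in> convex hull V \<and> vs ! i \<notin> ssupp x \<and>
      (set (take i vs) \<subseteq> ssupp x \<and> A \<subseteq> supp x \<and> \<not> supp x \<subseteq> M)"
  proof -
    have "opp i \<subseteq> ssupp x \<and> \<not> ssupp x \<subseteq> morse_verts i
        \<longleftrightarrow> set (take i vs) \<subseteq> ssupp x \<and> A \<subseteq> supp x \<and> \<not> supp x \<subseteq> M"
      if x: "x \<in> convex hull V" "vs ! i \<notin> ssupp x"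
      unfolding supp_coarse[OF x(1)] by (rule piece_mem_iff[OF i ssupp_nonempty[OF x(1)] x(2)])
    then show ?thesis by blast
  qed
  finally show "x \<in> simplex_realization (piece i) \<longleftrightarrow>
      x \<in> {x \<in> realization (relative_stellar (convex hull B) (complex_of (tile V A M))).
        vs ! i \<notin> ssupp x \<and> set (take i vs) \<subseteq> ssupp x}"
    unfolding realization_stellar by blast
qed

section \<open>Initial unions and the shelling\<close>

lemma inj_on_piece: "inj_on piece {..<length vs}"
proof (rule inj_onI)
  fix i j assume ij: "i \<in> {..<length vs}" "j \<in> {..<length vs}" "piece i = piece j"
  then have "convex hull (verts i) = convex hull (verts j)"
    by (metis piece_def underlying_tile)
  then have "verts i = verts j"
    using vertices_convex_hull[OF indep_verts] ij(1,2) by (metis lessThan_iff)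
  moreover have "vs ! i \<in> V" using nth_in_B[of i] ij B_subset by auto
  moreover from this have "vs ! i \<notin> verts i" using barycenter_notin by auto
  ultimately have "vs ! i = vs ! j" by blast
  then show "i = j" using ij distinct_vs by (simp add: nth_eq_iff_index_eq)
qed

lemma first_missing:
  assumes "\<not> set (take p vs) \<subseteq> G" "p \<le> length vs"
  obtains i where "i < p" "vs ! i \<notin> G" "set (take i vs) \<subseteq> G"
proof -
  let ?P = "\<lambda>i. i < p \<and> vs ! i \<notin> G"
  have ex: "\<exists>i. ?P i" using assms by (fastforce simp: in_set_conv_nth)
  define i where "i = Least ?P"
  have i: "?P i" unfolding i_def using LeastI_ex[OF ex] .
  have "vs ! j \<in> G" if "j < i" for j
    using not_less_Least[of j ?P] that i unfolding i_def by auto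
  then have "set (take i vs) \<subseteq> G" by (auto simp: in_set_conv_nth)
  with i that show ?thesis by blast
qed

text \<open>The choice of the first minimizing vertex is invisible in an initial union, which is
  thus cut out by finitely many closed simplices.\<close>

lemma Union_pieces:
  assumes p: "p \<le> length vs"
  shows "(\<Union>i<p. simplex_realization (piece i))
    = realization (relative_stellar (convex hull B) (complex_of (tile V A M)))
      \<inter> (\<Union>i<p. convex hull (verts i))" (is "?l = ?S \<inter> ?r")
proof (intro set_eqI iffI)
  fix x assume "x \<in> ?l"
  then obtain i where i: "i < p" "x \<in> simplex_realization (piece i)" by blast
  have "i < length vs" using i p by simp
  with i have "x \<in> ?S" "x \<in> convex hull (verts i)"
    using simplex_realization_piece by (blast, simp add: piece_def)
  with i show "x \<in> ?S \<inter> ?r" by blast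
next
  fix x assume x: "x \<in> ?S \<inter> ?r"
  then obtain j where j: "j < p" "x \<in> convex hull (verts j)" by blast
  then have "vs ! j \<notin> ssupp x"
    using mem_replace_iff_notin[OF nth_in_B[of j]] p by simp
  then have "\<not> set (take p vs) \<subseteq> ssupp x"
    using j p nth_in_take_iff[of j p] by auto
  then obtain i where i: "i < p" "vs ! i \<notin> ssupp x" "set (take i vs) \<subseteq> ssupp x"
    using first_missing p by blast
  then have "x \<in> simplex_realization (piece i)"
    using simplex_realization_piece[of i] x p by auto
  with i show "x \<in> ?l" by blast
qed

lemma set_pieces: "set pieces = piece ` {..<length vs}"
  by (simp add: pieces_def lessThan_atLeast0)

lemma shelling_pieces:
  "shelling (relative_stellar (convex hull B) (complex_of (tile V A M))) pieces"
proof -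
  let ?C = "relative_stellar (convex hull B) (complex_of (tile V A M))"
  let ?S = "realization ?C"
  have set_take: "set (take p pieces) = piece ` {..<p}" if "p \<le> length vs" for p
    using that by (simp add: pieces_def take_map lessThan_atLeast0)
  have "distinct pieces"
    using inj_on_piece by (simp add: pieces_def distinct_map lessThan_atLeast0)
  moreover have prefix: "closedin (top_of_set ?S) (\<Union>T\<in>set (take p pieces). simplex_realization T)"
    if p: "p \<le> length pieces" for p
  proof -
    have p': "p \<le> length vs" using p by (simp add: pieces_def)
    have "closed (\<Union>i<p. convex hull (verts i))"
      using finite_V by (intro closed_UN finite_lessThan ballI compact_imp_closed
          finite_imp_compact_convex_hull) simp
    then have "closedin (top_of_set ?S) (?S \<inter> (\<Union>i<p. convex hull (verts i)))"
      by (rule closedin_closed_Int)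
    then show ?thesis
      unfolding set_take[OF p'] Union_pieces[OF p', symmetric] by (simp add: image_image)
  qed
  moreover have "tiling ?C (set pieces)"
    unfolding tiling_def
  proof (intro conjI ballI allI)
    show "is_relative_complex ?C" by (rule is_relative_complex_stellar)
    show "is_relative_simplex T" if "T \<in> set pieces" for T
      using that is_relative_simplex_piece by (auto simp: set_pieces)
    show "underlying T \<in> fst ?C" if T: "T \<in> set pieces" for T
    proof -
      obtain i where i: "i < length vs" "T = piece i" using T by (auto simp: set_pieces)
      have v: "vs ! i \<in> B" by (rule nth_in_B[OF i(1)])
      then have "vs ! i \<notin> verts i" using barycenter_notin B_subset by auto
      with v have "\<not> B \<subseteq> verts i" by blast
      then have "verts i \<in> st (Pow V)" using coarse_subset[of "verts i"] by (auto simp: st_def)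
      then show ?thesis using i by (simp add: relative_stellar_tile piece_def)
    qed
    have disj: "simplex_realization (piece i) \<inter> simplex_realization (piece j) = {}"
      if "i < j" "j < length vs" for i j
      using that nth_in_take_iff[of i j] simplex_realization_piece[of i] simplex_realization_piece[of j]
      by auto
    show "disjoint_family_on simplex_realization (set pieces)"
      unfolding disjoint_family_on_def
    proof (intro ballI impI)
      fix T T' assume T: "T \<in> set pieces" "T' \<in> set pieces" "T \<noteq> T'"
      then obtain i j where ij: "i < length vs" "j < length vs" "T = piece i" "T' = piece j"
        by (auto simp: set_pieces)
      then consider "i < j" | "j < i" using T by (metis linorder_neqE_nat)
      then show "simplex_realization T \<inter> simplex_realization T' = {}"
        using disj[of i j] disj[of j i] ij by cases (simp_all add: Int_commute)
    qed
    have "x \<in> (\<Union>i<length vs. convex hull (verts i))" if "x \<in> ?S" for x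
    proof -
      have "\<not> set (take (length vs) vs) \<subseteq> ssupp x" using not_B_subset_ssupp set_vs by simp
      then obtain i where "i < length vs" "vs ! i \<notin> ssupp x" using first_missing by blast
      then show ?thesis
        using mem_replace_iff_notin[OF nth_in_B[of i], of x] that by (auto simp: realization_stellar)
    qed
    then show union: "(\<Union>T\<in>set pieces. simplex_realization T) = ?S"
      using Union_pieces[OF order_refl] by (auto simp: set_pieces)
    fix d :: nat
    \<comment> \<open>All pieces have dimension \<open>n\<close>, so the union to be shown closed is
      everything or empty.\<close>
    have dim: "aff_dim (underlying T) = int n" if T: "T \<in> set pieces" for T
    proof -
      obtain i where i: "i < length vs" "T = piece i" using T by (auto simp: set_pieces)
      then show ?thesis
        using aff_dim_convex_hull_independent[OF indep_verts[OF i(1)] order_refl] card_verts[OF i(1)]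
        by (simp add: piece_def)
    qed
    show "closedin (top_of_set ?S) (\<Union>T\<in>{T\<in>set pieces. aff_dim (underlying T) > int d}. simplex_realization T)"
    proof (cases "d < n")
      case True
      then have "{T\<in>set pieces. aff_dim (underlying T) > int d} = set pieces" using dim by auto
      then show ?thesis using union by simp
    next
      case False
      then have "{T\<in>set pieces. aff_dim (underlying T) > int d} = {}" using dim by auto
      then show ?thesis by (simp only: UN_empty closedin_empty)
    qed
  qed
  ultimately show ?thesis unfolding shelling_def by blast
qed

lemma morse_shelling_pieces:
  "morse_shelling (relative_stellar (convex hull B) (complex_of (tile V A M))) pieces"
  unfolding morse_shelling_def using shelling_pieces morse_tile_piece by (auto simp: set_pieces)


section \<open>Types of the pieces for the three orderings\<close>

lemma b_notin: "b \<notin> V" "b \<notin> B" "b \<notin> A" "b \<notin> M"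
  using barycenter_notin B_subset A_subset M_subset by blast+

text \<open>The element outside \<open>opp i\<close> is \<open>b\<close> if \<open>vs ! i\<close> is
  not in \<open>A\<close>, and the next vertex of the list otherwise. \<open>W\<close> will be
  \<open>V\<close> for basic pieces and \<open>M\<close> for pieces with a Morse face.\<close>

lemma opp_psubset:
  assumes i: "i < length vs" and W: "B \<subseteq> W" "b \<notin> W" "opp i \<subseteq> insert b (W - {vs ! i})"
    and last: "vs ! i \<in> A \<Longrightarrow> Suc i < length vs"
  shows "opp i \<subset> insert b (W - {vs ! i})"
proof (cases "vs ! i \<in> A")
  case True
  note S = last[OF True]
  have "vs ! Suc i \<in> B" "vs ! Suc i \<notin> set (take i vs)" "vs ! Suc i \<noteq> vs ! i"
    using nth_in_B[OF S] nth_in_take_iff[OF S, of i] i S distinct_vs by (auto simp: nth_eq_iff_index_eq)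
  moreover from this have "vs ! Suc i \<notin> opp i" using b_notin by (auto simp: opp_def)
  ultimately show ?thesis using W by blast
next
  case False
  then have "b \<notin> opp i" using set_take_subset_B[of i] b_notin by (auto simp: opp_def)
  then show ?thesis using W by blast
qed

text \<open>The element \<open>x\<close> has two tasks: it makes the Morse face disappear and shows
  that \<open>opp i\<close> is nonempty. The assumption \<open>last\<close> keeps
  \<open>opp i\<close> proper.\<close>

lemma regular_basic_piece:
  assumes i: "i < length vs" and last: "vs ! i \<in> A \<Longrightarrow> Suc i < length vs"
    and x: "x \<in> opp i" "x \<notin> pre_morse i"
  shows "regular_basic_tile n (piece i)"
proof -
  have "morse_verts i = {}" using x by (auto simp: morse_verts_def)
  moreover have "opp i \<subset> verts i"
    using opp_psubset[OF i B_subset b_notin(1) opp_subset[OF i] last] .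
  ultimately show ?thesis
    unfolding piece_def using regular_basic_tileI[OF indep_verts[OF i] card_verts[OF i]] x(1) by auto
qed

lemma isomorphic_piece:
  assumes i: "i < length vs"
    and opp: "(\<lambda>x. if x = b then vs ! i else x) ` opp i = A"
    and mv: "(\<lambda>x. if x = b then vs ! i else x) ` morse_verts i = M"
  shows "isomorphic_relative_simplices (piece i) (tile V A M)"
proof -
  have v: "vs ! i \<in> V" using nth_in_B[OF i] B_subset by blast
  have "bij_betw (\<lambda>x. if x = b then vs ! i else x) (verts i) V"
    using v b_notin by (auto simp: bij_betw_def inj_on_def image_iff)
  from isomorphic_tiles[OF indep_verts[OF i] indep this opp_subset[OF i] morse_verts_subset]
  show ?thesis unfolding piece_def opp mv .
qed

text \<open>These are the two ways to recover \<open>A\<close>: at the first vertex outside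
  \<open>A\<close>, where \<open>opp i = A\<close>, or, if \<open>B \<subseteq> A\<close>, at the
  last vertex, where \<open>opp i\<close> is \<open>A\<close> with \<open>vs ! i\<close> exchanged
  for \<open>b\<close>.\<close>

lemma opp_image:
  assumes i: "i < length vs"
    and "vs ! i \<notin> A \<and> set (take i vs) = A \<inter> B \<or> Suc i = length vs \<and> B \<subseteq> A"
  shows "(\<lambda>x. if x = b then vs ! i else x) ` opp i = A"
  using assms(2)
proof
  assume "vs ! i \<notin> A \<and> set (take i vs) = A \<inter> B"
  then have "opp i = A" by (auto simp: opp_def)
  then show ?thesis using b_notin by (auto simp: image_iff)
next
  assume *: "Suc i = length vs \<and> B \<subseteq> A"
  then have "set vs = set (take (Suc i) vs)" by simp
  then have "B = insert (vs ! i) (set (take i vs))"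
    using i by (simp add: take_Suc_conv_app_nth set_vs)
  moreover have "opp i = insert b (set (take i vs) \<union> (A - B))"
    using * nth_in_B[OF i] by (auto simp: opp_def)
  moreover have "(\<lambda>x. if x = b then vs ! i else x) ` (set (take i vs) \<union> (A - B)) = set (take i vs) \<union> (A - B)"
    using b_notin set_take_subset_B[of i] by (auto simp: image_iff)
  ultimately show ?thesis using * by auto
qed

text \<open>Before \<open>t\<close> the Morse face is lost because \<open>b\<close> is in
  \<open>opp i\<close> but not in \<open>pre_morse i\<close>; after \<open>t\<close> it is lost
  because \<open>vs ! t\<close> is in \<open>opp i\<close> but not in \<open>M\<close>. Hence the
  choice of \<open>vs ! t\<close> outside \<open>M\<close>.\<close>

lemma pieces_if_not_subset:
  assumes BM: "\<not> B \<subseteq> M" and t: "t < length vs"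
    and t_cases: "vs ! t \<notin> A \<and> vs ! t \<notin> M \<and> set (take t vs) = A \<inter> B \<or>
      Suc t = length vs \<and> B \<subseteq> A \<and> M = {}"
  shows "isomorphic_relative_simplices (piece t) (tile V A M)"
    and "i < length vs \<Longrightarrow> i \<noteq> t \<Longrightarrow> regular_basic_tile n (piece i)"
proof -
  have pre: "pre_morse i = M - {vs ! i}" for i using BM by (simp add: pre_morse_def)
  have opp: "(\<lambda>x. if x = b then vs ! t else x) ` opp t = A" using opp_image[OF t] t_cases by blast
  have "morse_verts t = M"
    using t_cases
  proof
    assume *: "vs ! t \<notin> A \<and> vs ! t \<notin> M \<and> set (take t vs) = A \<inter> B"
    then have "opp t = A" by (auto simp: opp_def)
    with * morse show ?thesis by (auto simp: morse_verts_def pre)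
  next
    assume "Suc t = length vs \<and> B \<subseteq> A \<and> M = {}"
    then have "M = {}" by blast
    then show ?thesis unfolding morse_verts_def pre by simp
  qed
  moreover have "(\<lambda>x. if x = b then vs ! t else x) ` M = M" using b_notin by (auto simp: image_iff)
  ultimately show "isomorphic_relative_simplices (piece t) (tile V A M)"
    by (intro isomorphic_piece t opp) simp
  assume i: "i < length vs" "i \<noteq> t"
  show "regular_basic_tile n (piece i)"
  proof (cases "i < t")
    case True
    then have "vs ! i \<in> A" using t_cases nth_in_take_iff[of i t] nth_in_B[of i] t i by auto
    then show ?thesis
      using True t b_notin by (intro regular_basic_piece[of i b] i) (auto simp: opp_def pre)
  next
    case False
    with i t t_cases have t': "vs ! t \<notin> M" "set (take t vs) = A \<inter> B" "t < i" by auto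
    then have "vs ! i \<notin> A" using nth_in_take_iff[of i t] nth_in_B[of i] i t by auto
    then show ?thesis
      using t' i t nth_in_take_iff[of t i]
      by (intro regular_basic_piece[of i "vs ! t"]) (auto simp: opp_def pre)
  qed
qed

text \<open>No Morse face is lost: \<open>A\<close> and \<open>B\<close> lie in \<open>M\<close>, so
  \<open>opp i\<close> always fits into \<open>M\<close> with \<open>vs ! i\<close> exchanged for
  \<open>b\<close>. It fits strictly unless the last vertex is in \<open>A\<close>; this forces
  \<open>B \<subseteq> A\<close>, and then the last piece is the one isomorphic to the tile.\<close>

lemma pieces_if_subset:
  assumes BM: "B \<subseteq> M" and t: "t < length vs"
    and t_cases: "vs ! t \<notin> A \<and> set (take t vs) = A \<inter> B \<or> Suc t = length vs \<and> B \<subseteq> A"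
  shows "isomorphic_relative_simplices (piece t) (tile V A M)"
    and "i < length vs \<Longrightarrow> i \<noteq> t \<Longrightarrow> regular_morse_tile n (piece i)"
proof -
  have AM: "A \<subseteq> M" "card M + 1 \<le> n" using BM B_nonempty morse by auto
  have mv: "opp i \<subseteq> insert b (M - {vs ! i})" "morse_verts i = insert b (M - {vs ! i})"
    if i: "i < length vs" for i
  proof -
    have "vs ! i \<notin> set (take i vs)" "vs ! i \<in> B" using nth_in_take_iff[OF i, of i] nth_in_B[OF i] i by auto
    then show "opp i \<subseteq> insert b (M - {vs ! i})"
      using AM BM set_take_subset_B[of i] by (auto simp: opp_def)
    then show "morse_verts i = insert b (M - {vs ! i})"
      using BM by (simp add: morse_verts_def pre_morse_def)
  qed
  have "vs ! t \<in> M" using nth_in_B[OF t] BM by blast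
  then have "(\<lambda>x. if x = b then vs ! t else x) ` morse_verts t = M"
    unfolding mv(2)[OF t] using b_notin by (auto simp: image_iff)
  then show "isomorphic_relative_simplices (piece t) (tile V A M)"
    by (intro isomorphic_piece t opp_image t_cases)
  assume i: "i < length vs" "i \<noteq> t"
  have "Suc i < length vs" if "vs ! i \<in> A"
    using t_cases that nth_in_take_iff[of i t] nth_in_B[of i] i t by auto
  then have "opp i \<subset> morse_verts i"
    unfolding mv(2)[OF i(1)] by (intro opp_psubset i BM b_notin mv(1))
  moreover have "card (morse_verts i) + 1 \<le> n"
    using morse_verts_cases[OF i(1)] mv(2)[OF i(1)] by auto
  ultimately show "regular_morse_tile n (piece i)"
    unfolding piece_def
    by (intro regular_morse_tileI indep_verts card_verts morse_verts_subset i)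
qed

text \<open>Positions count from 0. For \<open>card A \<le> i \<le> d\<close> the opposite vertices
  are the first \<open>i\<close> vertices of \<open>M\<close>, and the Morse face has the
  \<open>d\<close> vertices of \<open>M\<close> other than \<open>vs ! i\<close>. At
  \<open>i = d\<close> both sets coincide. At \<open>i = d + 1\<close> the vertex
  \<open>vs ! i\<close> is outside \<open>M\<close>, and both sets are \<open>M\<close>. In the
  remaining pieces \<open>opp i\<close> leaves \<open>M\<close>, through \<open>b\<close> before
  \<open>card A\<close> and through \<open>vs ! (d + 1)\<close> after \<open>d + 1\<close>.\<close>

lemma pieces_if_strict_superset:
  assumes MB: "M \<subset> B" and AM: "A \<subset> M" and d: "card M = d + 1"
    and takes: "set (take (card A) vs) = A" "set (take (d + 1) vs) = M"
  shows "critical_tile n d (piece d)" "critical_tile n (d + 1) (piece (d + 1))" "d + 1 < length vs"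
    and "j \<in> {card A..<d} \<Longrightarrow> regular_morse_tile n (piece j) \<and>
      (\<exists>\<nu>. morse_tile n j \<nu> (piece j) \<and> aff_dim \<nu> = int d - 1)"
    and "i < length vs \<Longrightarrow> i < card A \<or> d + 1 < i \<Longrightarrow> regular_basic_tile n (piece i)"
proof -
  have fin: "finite M" "finite A" using finite_V M_subset A_subset finite_subset by blast+
  have nM: "card M + 1 \<le> n" using AM morse by blast
  have len: "d + 1 < length vs"
    using psubset_card_mono[OF finite_B MB] d length_vs by simp
  then show "d + 1 < length vs" .
  have cA: "card A < d + 1" using psubset_card_mono[OF fin(1) AM] d by simp
  have pre: "pre_morse i = M - {vs ! i}" for i using MB by (auto simp: pre_morse_def)
  have inA: "vs ! i \<in> A \<longleftrightarrow> i < card A" if "i < length vs" for i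
    using nth_in_take_iff[OF that, of "card A"] takes(1) cA len by simp
  have inM: "vs ! i \<in> M \<longleftrightarrow> i < d + 1" if "i < length vs" for i
    using nth_in_take_iff[OF that, of "d + 1"] takes(2) len by simp
  have opp: "opp i = set (take i vs)" if "i < length vs" "card A \<le> i" for i
    using inA[OF that(1)] that AM MB by (auto simp: opp_def)
  have card_take: "card (set (take i vs)) = i" if "i < length vs" for i
    using distinct_card[OF distinct_take[OF distinct_vs, of i]] that by simp
  have take_sub: "set (take i vs) \<subseteq> M - {vs ! i}" if "i \<le> d" for i
  proof -
    have "set (take i vs) \<subseteq> set (take (d + 1) vs)"
      using that by (intro set_take_subset_set_take) simp
    then show ?thesis using takes(2) nth_in_take_iff[of i i] that len by auto
  qed
  have mv: "morse_verts i = M - {vs ! i}" if "card A \<le> i" "i \<le> d" for i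
    using take_sub[of i] opp[of i] that len by (simp add: morse_verts_def pre)
  have card_mv: "card (M - {vs ! i}) = d" if "i \<le> d" for i
    using inM[of i] that len d fin by simp
  \<comment> \<open>One set contains the other, and both have \<open>d\<close> elements.\<close>
  have "M - {vs ! d} = set (take d vs)"
    using card_subset_eq[OF _ take_sub[of d]] card_take[of d] card_mv[of d] fin len by simp
  then have "piece d = tile (verts d) (set (take d vs)) (set (take d vs))"
    using mv[of d] opp[of d] cA len by (simp add: piece_def)
  moreover have "critical_tile n (card (set (take d vs))) (tile (verts d) (set (take d vs)) (set (take d vs)))"
    using opp_subset[of d] opp[of d] cA len card_take[of d] d nM
    by (intro critical_tileI indep_verts card_verts) auto
  ultimately show "critical_tile n d (piece d)" using card_take[of d] len by simp
  have "opp (d + 1) = M" using opp[of "d + 1"] len cA takes by simp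
  moreover have "morse_verts (d + 1) = M"
    using calculation inM[of "d + 1"] len by (simp add: morse_verts_def pre)
  moreover have "critical_tile n (card M) (tile (verts (d + 1)) M M)"
    using opp_subset[of "d + 1"] calculation len nM
    by (intro critical_tileI indep_verts card_verts) auto
  ultimately show "critical_tile n (d + 1) (piece (d + 1))" by (simp add: piece_def d)
  show "regular_morse_tile n (piece j) \<and> (\<exists>\<nu>. morse_tile n j \<nu> (piece j) \<and> aff_dim \<nu> = int d - 1)"
    if j: "j \<in> {card A..<d}"
  proof -
    have j': "card A \<le> j" "j \<le> d" "j < length vs" using j len by auto
    have "opp j \<subset> morse_verts j"
      using mv[of j] opp[of j] take_sub[of j] card_take[of j] card_mv[of j] j j' by auto
    then have "regular_morse_tile n (piece j)"
      unfolding piece_def using mv[of j] card_mv[of j] j' d nM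
      by (intro regular_morse_tileI indep_verts card_verts morse_verts_subset) auto
    moreover have "morse_tile n j (convex hull morse_verts j) (piece j)"
      using morse_tile_piece[of j] opp[of j] card_take[of j] j' by simp
    moreover have "aff_dim (convex hull morse_verts j) = int d - 1"
      using aff_dim_convex_hull_independent[OF indep_verts morse_verts_subset, of j] mv[of j]
        card_mv[of j] j' by simp
    ultimately show ?thesis by blast
  qed
  assume i: "i < length vs" "i < card A \<or> d + 1 < i"
  show "regular_basic_tile n (piece i)"
    using i(2)
  proof
    assume "i < card A"
    then show ?thesis
      using i inA[of i] cA len b_notin by (intro regular_basic_piece[of i b]) (auto simp: opp_def pre)
  next
    assume "d + 1 < i"
    then show ?thesis
      using i inA[of i] cA len inM[of "d + 1"] nth_in_take_iff[of "d + 1" i]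
      by (intro regular_basic_piece[of i "vs ! (d + 1)"]) (auto simp: opp_def pre)
  qed
qed

end

lemma list_of_chain:
  assumes "finite Z" "X \<subseteq> Y" "Y \<subseteq> Z"
  obtains vs where "distinct vs" "set vs = Z" "set (take (card X) vs) = X" "set (take (card Y) vs) = Y"
proof -
  obtain xs ys zs where *: "set xs = X" "distinct xs" "set ys = Y - X" "distinct ys"
      "set zs = Z - Y" "distinct zs"
    using assms finite_distinct_list by (metis finite_Diff finite_subset)
  have "card X = length xs" using * distinct_card by metis
  moreover have "card Y = length (xs @ ys)"
    using * assms(2) distinct_card[of "xs @ ys"] by (simp add: Un_absorb1)
  ultimately show ?thesis
    using * assms by (intro that[of "xs @ ys @ zs"]) auto
qed

theorem theorem1p1:
  fixes T :: "'a::euclidean_space relative_simplex" and \<mu> \<tau> :: "'a set" and n ord :: nat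
  assumes "morse_tile n ord \<mu> T"
    and "\<tau> face_of underlying T"
    and "aff_dim \<tau> > 0"
  shows
    "(\<not> \<tau> \<subseteq> \<mu> \<longrightarrow>
       (\<exists>Ts T\<^sub>0. morse_shelling (relative_stellar \<tau> (complex_of T)) Ts \<and>
          T\<^sub>0 \<in> set Ts \<and> isomorphic_relative_simplices T\<^sub>0 T \<and>
          (\<forall>X\<in>set Ts - {T\<^sub>0}. regular_basic_tile n X))) \<and>
     (\<tau> \<subseteq> \<mu> \<longrightarrow>
       (\<exists>Ts T\<^sub>0. morse_shelling (relative_stellar \<tau> (complex_of T)) Ts \<and>
          T\<^sub>0 \<in> set Ts \<and> isomorphic_relative_simplices T\<^sub>0 T \<and>
          (\<forall>X\<in>set Ts - {T\<^sub>0}. regular_morse_tile n X))) \<and>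
     (\<forall>d::nat. aff_dim \<mu> = int d \<and> \<mu> \<subset> \<tau> \<and> ord \<le> d \<longrightarrow>
       (\<exists>Ts C C' M. morse_shelling (relative_stellar \<tau> (complex_of T)) Ts \<and>
          C \<in> set Ts \<and> critical_tile n d C \<and>
          C' \<in> set Ts \<and> critical_tile n (d + 1) C' \<and>
          M \<subseteq> set Ts \<and> card M = d - ord \<and>
          (\<forall>X\<in>M. regular_morse_tile n X \<and>
             (\<exists>j\<in>{ord..<d}. \<exists>\<nu>. morse_tile n j \<nu> X \<and> aff_dim \<nu> = int d - 1)) \<and>
          (\<forall>j\<in>{ord..<d}. \<exists>X\<in>M. \<exists>\<nu>. morse_tile n j \<nu> X \<and> aff_dim \<nu> = int d - 1) \<and>
          (\<forall>X\<in>set Ts - ({C, C'} \<union> M). regular_basic_tile n X)))"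
proof -
  obtain V A M where V: "\<not> affine_dependent V" "card V = n + 1" and A: "A \<subseteq> V" "card A = ord"
    and M: "M \<subseteq> V" "\<mu> = convex hull M" "M = {} \<or> A \<subseteq> M \<and> card M + 1 \<le> n" and T: "T = tile V A M"
    using assms(1) by (rule morse_tile_cases)
  obtain B where B: "B \<subseteq> V" "\<tau> = convex hull B"
    using assms(2) face_of_convex_hull_affine_independent[OF V(1)] by (auto simp: T)
  have card_B: "2 \<le> card B"
    using assms(3) aff_dim_convex_hull_independent[OF V(1) B(1)] B(2) by simp
  have finB: "finite B" using B(1) aff_independent_finite[OF V(1)] by (rule finite_subset)
  have \<tau>\<mu>: "\<tau> \<subseteq> \<mu> \<longleftrightarrow> B \<subseteq> M"
    unfolding M(2) B(2) by (rule convex_hull_subset_iff[OF V(1) B(1) M(1)])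
  have tile: "stellar_tile V B A M vs n"
    if "distinct vs" "set vs = B" "set (take (card (A \<inter> B)) vs) = A \<inter> B" for vs
  proof (unfold_locales)
    fix i assume i: "i < length vs" "vs ! i \<notin> A"
    then have "\<not> i < card (A \<inter> B)"
      using that by (metis Int_iff in_set_conv_nth length_take min_less_iff_conj nth_take)
    then show "A \<inter> B \<subseteq> set (take i vs)"
      using that(3) set_take_subset_set_take[of "card (A \<inter> B)" i vs] by simp
  qed (use V A M B card_B that in auto)
  show ?thesis
  proof (intro conjI impI allI)
    assume "\<not> \<tau> \<subseteq> \<mu>"
    then have BM: "\<not> B \<subseteq> M" using \<tau>\<mu> by simp
    \<comment> \<open>\<open>A \<inter> B\<close> is followed by the vertices outside
      \<open>M\<close>, so that position \<open>card (A \<inter> B)\<close> holds a vertex outside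
      \<open>A\<close> and \<open>M\<close> unless \<open>B \<subseteq> A\<close>.\<close>
    obtain vs where vs: "distinct vs" "set vs = B" "set (take (card (A \<inter> B)) vs) = A \<inter> B"
        "set (take (card (A \<inter> B \<union> (B - M))) vs) = A \<inter> B \<union> (B - M)"
      using list_of_chain[of B "A \<inter> B" "A \<inter> B \<union> (B - M)"] finB by auto
    interpret stellar_tile V B A M vs n by (rule tile[OF vs(1-3)])
    obtain t where t: "t < length vs" "vs ! t \<notin> A \<and> vs ! t \<notin> M \<and> set (take t vs) = A \<inter> B \<or>
        Suc t = length vs \<and> B \<subseteq> A \<and> M = {}"
    proof (cases "B \<subseteq> A")
      case True
      then have "M = {}" using M(3) BM by blast
      with True card_B show ?thesis by (intro that[of "length vs - 1"]) (auto simp: length_vs)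
    next
      case False
      let ?t = "card (A \<inter> B)"
      \<comment> \<open>If \<open>M\<close> is empty, a vertex of \<open>B\<close> outside
        \<open>A\<close> is new; otherwise \<open>A \<subseteq> M\<close>, and any vertex of
        \<open>B\<close> outside \<open>M\<close> is new.\<close>
      have "A \<inter> B \<subset> A \<inter> B \<union> (B - M)" using M(3) BM False by blast
      then have t: "?t < card (A \<inter> B \<union> (B - M))" using finB by (intro psubset_card_mono) auto
      also have "\<dots> \<le> length vs" unfolding length_vs using finB by (intro card_mono) auto
      finally have l: "?t < length vs" .
      have "vs ! ?t \<in> A \<inter> B \<union> (B - M)"
        using vs(4) nth_in_take_iff[OF l] t \<open>_ \<le> length vs\<close> by blast
      moreover have "vs ! ?t \<notin> A \<inter> B" using vs(3) nth_in_take_iff[OF l, of ?t] l by simp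
      ultimately show ?thesis using vs(3) l by (intro that[of ?t]) auto
    qed
    show "\<exists>Ts T\<^sub>0. morse_shelling (relative_stellar \<tau> (complex_of T)) Ts \<and>
          T\<^sub>0 \<in> set Ts \<and> isomorphic_relative_simplices T\<^sub>0 T \<and>
          (\<forall>X\<in>set Ts - {T\<^sub>0}. regular_basic_tile n X)"
      unfolding B(2) T
      using morse_shelling_pieces pieces_if_not_subset[OF BM t] t(1)
      by (intro exI[of _ pieces] exI[of _ "piece t"]) (unfold set_pieces, blast)
  next
    assume "\<tau> \<subseteq> \<mu>"
    then have BM: "B \<subseteq> M" using \<tau>\<mu> by simp
    \<comment> \<open>Only \<open>A \<inter> B\<close> has to come first here, so the chain is
      degenerate.\<close>
    obtain vs where vs: "distinct vs" "set vs = B" "set (take (card (A \<inter> B)) vs) = A \<inter> B"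
      using list_of_chain[of B "A \<inter> B" "A \<inter> B"] finB by auto
    interpret stellar_tile V B A M vs n by (rule tile[OF vs])
    obtain t where t: "t < length vs" "vs ! t \<notin> A \<and> set (take t vs) = A \<inter> B \<or>
        Suc t = length vs \<and> B \<subseteq> A"
    proof (cases "B \<subseteq> A")
      case True
      with card_B show ?thesis by (intro that[of "length vs - 1"]) (auto simp: length_vs)
    next
      case False
      let ?t = "card (A \<inter> B)"
      have l: "?t < length vs" unfolding length_vs using finB False by (intro psubset_card_mono) auto
      moreover have "vs ! ?t \<notin> A \<inter> B" using vs(3) nth_in_take_iff[OF l, of ?t] l by simp
      ultimately show ?thesis using vs(3) nth_in_B[OF l] by (intro that[of ?t]) auto
    qed
    show "\<exists>Ts T\<^sub>0. morse_shelling (relative_stellar \<tau> (complex_of T)) Ts \<and>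
          T\<^sub>0 \<in> set Ts \<and> isomorphic_relative_simplices T\<^sub>0 T \<and>
          (\<forall>X\<in>set Ts - {T\<^sub>0}. regular_morse_tile n X)"
      unfolding B(2) T
      using morse_shelling_pieces pieces_if_subset[OF BM t] t(1)
      by (intro exI[of _ pieces] exI[of _ "piece t"]) (unfold set_pieces, blast)
  next
    fix d :: nat
    assume *: "aff_dim \<mu> = int d \<and> \<mu> \<subset> \<tau> \<and> ord \<le> d"
    have d: "card M = d + 1"
      using * aff_dim_convex_hull_independent[OF V(1) M(1)] M(2) by simp
    have "M \<subseteq> B"
      using * convex_hull_subset_iff[OF V(1) M(1) B(1)] unfolding M(2) B(2) by blast
    then have MB: "M \<subset> B" using * M(2) B(2) by blast
    have "M \<noteq> {}" using d by auto
    \<comment> \<open>The inclusion is strict because \<open>A\<close> has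
      \<open>ord \<le> d\<close> elements and \<open>M\<close> has \<open>d + 1\<close>.\<close>
    then have AM: "A \<subset> M" using M(3) A(2) d * by auto
    then have AB: "A \<inter> B = A" using MB by blast
    obtain vs where vs: "distinct vs" "set vs = B" "set (take (card A) vs) = A"
        "set (take (d + 1) vs) = M"
      using list_of_chain[of B A M] finB AM MB d by auto
    interpret stellar_tile V B A M vs n by (rule tile) (use vs AB in auto)
    note claim = pieces_if_strict_superset[OF MB AM d vs(3,4), unfolded A(2)]
    have mono: "{ord..<d} \<subseteq> {..<length vs}" using claim(3) by auto
    show "\<exists>Ts C C' M. morse_shelling (relative_stellar \<tau> (complex_of T)) Ts \<and>
          C \<in> set Ts \<and> critical_tile n d C \<and>
          C' \<in> set Ts \<and> critical_tile n (d + 1) C' \<and>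
          M \<subseteq> set Ts \<and> card M = d - ord \<and>
          (\<forall>X\<in>M. regular_morse_tile n X \<and>
             (\<exists>j\<in>{ord..<d}. \<exists>\<nu>. morse_tile n j \<nu> X \<and> aff_dim \<nu> = int d - 1)) \<and>
          (\<forall>j\<in>{ord..<d}. \<exists>X\<in>M. \<exists>\<nu>. morse_tile n j \<nu> X \<and> aff_dim \<nu> = int d - 1) \<and>
          (\<forall>X\<in>set Ts - ({C, C'} \<union> M). regular_basic_tile n X)"
      unfolding B(2) T
    proof (rule exI[of _ pieces], rule exI[of _ "piece d"], rule exI[of _ "piece (d + 1)"],
        rule exI[of _ "piece ` {ord..<d}"], intro conjI)
      show "\<forall>X\<in>piece ` {ord..<d}. regular_morse_tile n X \<and>
          (\<exists>j\<in>{ord..<d}. \<exists>\<nu>. morse_tile n j \<nu> X \<and> aff_dim \<nu> = int d - 1)"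
        using claim(4) by blast
      show "\<forall>j\<in>{ord..<d}. \<exists>X\<in>piece ` {ord..<d}. \<exists>\<nu>. morse_tile n j \<nu> X \<and> aff_dim \<nu> = int d - 1"
        using claim(4) by blast
      show "card (piece ` {ord..<d}) = d - ord"
        using card_image[OF inj_on_subset[OF inj_on_piece mono]] by simp
      show "\<forall>X\<in>set pieces - ({piece d, piece (d + 1)} \<union> piece ` {ord..<d}). regular_basic_tile n X"
      proof
        fix X assume X: "X \<in> set pieces - ({piece d, piece (d + 1)} \<union> piece ` {ord..<d})"
        then obtain i where i: "i < length vs" "X = piece i" by (auto simp: set_pieces)
        with X have "i \<noteq> d" "i \<noteq> d + 1" "i \<notin> {ord..<d}" by auto
        then have "i < ord \<or> d + 1 < i" by auto
        then show "regular_basic_tile n X" using claim(5) i by simp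
      qed
    qed (use morse_shelling_pieces claim(1-4) mono in \<open>auto simp: set_pieces\<close>)
  qed
qed

end
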